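(* Given the graph $\Gamma_e(\mathcal A_{n+1})$ up to isomorphism (without labels on its vertices): if $n\ge 3$, one can determine $\gamma_n$ and, if $\gamma_n=1$, find $C(e_0)$; if $n\ge 4$, one can also find $C(\tilde e_0)$ and thus determine $\gamma_{n-1}$. Precisely, let $\gamma=(\gamma_0,\dots,\gamma_n)$ and $\lambda=(\lambda_0,\dots,\lambda_n)$ be two sequences in $\{1,-1\}^{n+1}$ such that $\Gamma_e(\mathcal A^{\gamma}_{n+1})$ and $\Gamma_e(\mathcal A^{\lambda}_{n+1})$ are isomorphic graphs. (1) If $n\ge 3$, then $\gamma_n=\lambda_n$, and if moreover $\gamma_n=1$, then there is a graph isomorphism $\Gamma_e(\mathcal A^{\gamma}_{n+1})\to\Gamma_e(\mathcal A^{\lambda}_{n+1})$ mapping $C(e_0)$ onto $C(e_0)$. (2) If $n\ge 4$, then also $\gamma_{n-1}=\lambda_{n-1}$, and there is a graph isomorphism $\Gamma_e(\mathcal A^{\gamma}_{n+1})\to\Gamma_e(\mathcal A^{\lambda}_{n+1})$ mapping $C(\tilde e_0)$ onto $C(\tilde e_0)$.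
   Context: Cayley–Dickson algebras: $\mathcal A_0=\mathbb R$ with trivial conjugation and basis element $e^{(0)}_0=1$. For $\gamma_k\in\{1,-1\}$, $\mathcal A_{k+1}=\mathcal A_k\{\gamma_k\}$ consists of pairs $(a,b)$ of elements of $\mathcal A_k$ with componentwise linear operations, product $(a,b)(c,d)=(ac+\gamma_k\bar d b,\ da+b\bar c)$ and conjugation $\overline{(a,b)}=(\bar a,-b)$. For a sequence $\gamma=(\gamma_0,\dots,\gamma_n)$, $\mathcal A_{n+1}=\mathcal A^{\gamma}_{n+1}=\mathcal A_{n+1}\{\gamma_0,\dots,\gamma_n\}$ and $\mathcal A_n=\mathcal A_n\{\gamma_0,\dots,\gamma_{n-1}\}$. The standard basis of $\mathcal A_{k+1}$ is $e^{(k+1)}_j=(e^{(k)}_j,0)$ for $0\le j<2^k$ and $e^{(k+1)}_j=(0,e^{(k)}_{j-2^k})$ for $2^k\le j<2^{k+1}$. $\mathcal E_n$ is the standard basis of $\mathcal A_n$, $e_0$ is the unit, $\mathcal E'_n=\mathcal E_n\setminus\{e_0\}$, and $\tilde e_0=(0,e_0)=e^{(n)}_{2^{n-1}}\in\mathcal A_n$. Two elements $u,v$ of an algebra are orthogonal if $uv=vu=0$. The graph $\Gamma_e(\mathcal A_{n+1})$: vertices are the lines $\mathbb R(a,b)\subset\mathcal A_{n+1}$ spanned by zero divisors $(a,b)$ with $a\in\mathcal E'_n$, $b\in\pm\mathcal E_n$; two distinct lines are adjacent iff their generators are orthogonal. For $y\in\mathcal E_n$, $C(y)$ is the induced subgraph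 of $\Gamma_e(\mathcal A_{n+1})$ on the vertices $(a,b)$ with $ab=\pm y$. *)

theory Defs
  imports Complex_Main "Graph_Theory.Digraph_Isomorphism"
begin

(* An element of the k-th algebra of the Cayley-Dickson sequence is a complete binary tree of
   depth k with real leaves.  The operations below are only meaningful on arguments of equal depth. *)
datatype cd = Sc real | Pr cd cd

primrec cd_carrier :: "nat \<Rightarrow> cd set" where
  "cd_carrier 0 = range Sc"
| "cd_carrier (Suc k) = {Pr a b |a b. a \<in> cd_carrier k \<and> b \<in> cd_carrier k}"

primrec cd_zero :: "nat \<Rightarrow> cd" where
  "cd_zero 0 = Sc 0"
| "cd_zero (Suc k) = Pr (cd_zero k) (cd_zero k)"

primrec cd_scale :: "real \<Rightarrow> cd \<Rightarrow> cd" where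
  "cd_scale r (Sc x) = Sc (r * x)"
| "cd_scale r (Pr a b) = Pr (cd_scale r a) (cd_scale r b)"

abbreviation cd_neg :: "cd \<Rightarrow> cd" where
  "cd_neg \<equiv> cd_scale (-1)"

fun cd_add :: "cd \<Rightarrow> cd \<Rightarrow> cd" where
  "cd_add (Sc x) (Sc y) = Sc (x + y)"
| "cd_add (Pr a b) (Pr c d) = Pr (cd_add a c) (cd_add b d)"

primrec cd_conj :: "cd \<Rightarrow> cd" where
  "cd_conj (Sc x) = Sc x"
| "cd_conj (Pr a b) = Pr (cd_conj a) (cd_neg b)"

(* cd_mult \<gamma> k is the product of the k-th algebra, with parameters \<gamma> 0, ..., \<gamma> (k - 1). *)
fun cd_mult :: "(nat \<Rightarrow> real) \<Rightarrow> nat \<Rightarrow> cd \<Rightarrow> cd \<Rightarrow> cd" where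
  "cd_mult \<gamma> 0 (Sc x) (Sc y) = Sc (x * y)"
| "cd_mult \<gamma> (Suc k) (Pr a b) (Pr c d) =
     Pr (cd_add (cd_mult \<gamma> k a c) (cd_scale (\<gamma> k) (cd_mult \<gamma> k (cd_conj d) b)))
        (cd_add (cd_mult \<gamma> k d a) (cd_mult \<gamma> k b (cd_conj c)))"

primrec cd_basis :: "nat \<Rightarrow> nat \<Rightarrow> cd" where
  "cd_basis 0 j = Sc 1"
| "cd_basis (Suc k) j =
     (if j < 2 ^ k then Pr (cd_basis k j) (cd_zero k)
      else Pr (cd_zero k) (cd_basis k (j - 2 ^ k)))"

definition cd_basis_set :: "nat \<Rightarrow> cd set" where
  "cd_basis_set k = cd_basis k ` {..<2 ^ k}"

definition cd_orthogonal :: "(nat \<Rightarrow> real) \<Rightarrow> nat \<Rightarrow> cd \<Rightarrow> cd \<Rightarrow> bool" where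
  "cd_orthogonal \<gamma> k u v \<longleftrightarrow> cd_mult \<gamma> k u v = cd_zero k \<and> cd_mult \<gamma> k v u = cd_zero k"

(* One-sided zero divisors are allowed.  For the elements used as vertices below the left and the
   right notion agree: these elements x satisfy cd_conj x = - x, and conjugation reverses products. *)
definition cd_zero_divisor :: "(nat \<Rightarrow> real) \<Rightarrow> nat \<Rightarrow> cd \<Rightarrow> bool" where
  "cd_zero_divisor \<gamma> k u \<longleftrightarrow> u \<in> cd_carrier k \<and> u \<noteq> cd_zero k \<and>
     (\<exists>v \<in> cd_carrier k. v \<noteq> cd_zero k \<and>
        (cd_mult \<gamma> k u v = cd_zero k \<or> cd_mult \<gamma> k v u = cd_zero k))"

definition cd_line :: "cd \<Rightarrow> cd set" where
  "cd_line u = range (\<lambda>r. cd_scale r u)"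

definition gamma_e_generators :: "(nat \<Rightarrow> real) \<Rightarrow> nat \<Rightarrow> (cd \<times> cd) set" where
  "gamma_e_generators \<gamma> n =
     {(a, b). a \<in> cd_basis_set n - {cd_basis n 0} \<and>
              b \<in> cd_basis_set n \<union> cd_neg ` cd_basis_set n \<and>
              cd_zero_divisor \<gamma> (Suc n) (Pr a b)}"

(* The graph on lines in the (n+1)-st algebra, as a symmetric loop-free digraph: every edge
   {p, q} is represented by the two arcs (p, q) and (q, p). *)
definition gamma_e :: "(nat \<Rightarrow> real) \<Rightarrow> nat \<Rightarrow> (cd set, cd set \<times> cd set) pre_digraph" where
  "gamma_e \<gamma> n =
     \<lparr> verts = {cd_line (Pr a b) |a b. (a, b) \<in> gamma_e_generators \<gamma> n},
       arcs = {(cd_line (Pr a b), cd_line (Pr c d)) |a b c d.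
                 (a, b) \<in> gamma_e_generators \<gamma> n \<and> (c, d) \<in> gamma_e_generators \<gamma> n \<and>
                 cd_line (Pr a b) \<noteq> cd_line (Pr c d) \<and>
                 cd_orthogonal \<gamma> (Suc n) (Pr a b) (Pr c d)},
       tail = fst, head = snd \<rparr>"

definition gamma_e_C ::
    "(nat \<Rightarrow> real) \<Rightarrow> nat \<Rightarrow> cd \<Rightarrow> (cd set, cd set \<times> cd set) pre_digraph" where
  "gamma_e_C \<gamma> n y =
     gamma_e \<gamma> n \<restriction>
       {cd_line (Pr a b) |a b. (a, b) \<in> gamma_e_generators \<gamma> n \<and>
                               (cd_mult \<gamma> n a b = y \<or> cd_mult \<gamma> n a b = cd_neg y)}"

definition is_graph_iso ::
    "('a, 'b, 'c, 'd) digraph_isomorphism \<Rightarrow> ('a, 'b) pre_digraph \<Rightarrow> ('c, 'd) pre_digraph \<Rightarrow> bool" where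
  "is_graph_iso f G H \<longleftrightarrow> pre_digraph.digraph_isomorphism G f \<and> H = app_iso f G"

end

theory Submission
  imports Defs
begin

text \<open>
  Basis elements multiply as \<open>e\<^sub>i e\<^sub>j = \<plusminus>e\<^bsub>i xor j\<^esub>\<close>, so orthogonality of \<open>(e\<^sub>i, s e\<^sub>k)\<close> and
  \<open>(e\<^sub>j, t e\<^sub>l)\<close> forces \<open>i xor k = j xor l =: y\<close>.  The graph thus splits into blocks, one for each
  \<open>y\<close>, and each block is a signed double cover: for given \<open>i, j\<close> either no sign works or exactly
  one product \<open>s t\<close> does.  Three local invariants single out the relevant blocks.

  \<^item> A vertex of degree \<open>2 ^ n - 2\<close> all of whose neighbours have this degree lies in \<open>C(e\<^sub>0)\<close>, and
    such vertices exist iff \<open>\<gamma>\<^sub>n = 1\<close>.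
  \<^item> If \<open>\<gamma>\<^bsub>n-1\<^esub> = \<gamma>\<^sub>n\<close>, then in the block of \<open>(0, 1)\<close> all degrees are \<open>2 ^ n - 4\<close> and there is no
    triangle; for \<open>n \<ge> 4\<close> every other block with these degrees contains triangles, so the block is
    determined by the graph.
  \<^item> If \<open>\<gamma>\<^bsub>n-1\<^esub> = - \<gamma>\<^sub>n\<close>, the block of \<open>(0, 1)\<close> need not be invariant.  But it depends only on
    \<open>\<gamma>\<^bsub>n-1\<^esub>\<close> and \<open>\<gamma>\<^sub>n\<close>, and an isomorphism maps it onto some full block, so exchanging these two
    blocks corrects the isomorphism.
\<close>

unbundle bit_operations_syntax

section \<open>Signs of products of basis elements\<close>

lemma xor_less_two_power:
  fixes i j :: nat
  assumes "i < 2 ^ k" "j < 2 ^ k"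
  shows "i XOR j < 2 ^ k"
  using assms by (metis take_bit_nat_eq_self_iff take_bit_xor)

lemma two_power_add_eq_xor:
  fixes i :: nat
  assumes "i < 2 ^ k"
  shows "2 ^ k + i = 2 ^ k XOR i"
proof (rule disjunctive_add_eq_xor)
  have "\<not> bit i k"
    using assms by (metis bit_take_bit_iff take_bit_nat_eq_self_iff less_irrefl)
  then show "2 ^ k AND i = 0"
    by (metis and_exp_eq_0_iff_not_bit and.commute)
qed

lemma xor_high_low:
  fixes i j :: nat
  assumes "i < 2 ^ k" "j < 2 ^ k"
  shows "(2 ^ k + i) XOR j = 2 ^ k + (i XOR j)"
  using assms by (simp add: two_power_add_eq_xor xor_less_two_power xor.assoc)

lemma xor_low_high:
  fixes i j :: nat
  assumes "i < 2 ^ k" "j < 2 ^ k"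
  shows "i XOR (2 ^ k + j) = 2 ^ k + (i XOR j)"
  using assms by (simp add: two_power_add_eq_xor xor_less_two_power xor.left_commute)

lemma xor_high_high:
  fixes i j :: nat
  assumes "i < 2 ^ k" "j < 2 ^ k"
  shows "(2 ^ k + i) XOR (2 ^ k + j) = i XOR j"
proof -
  have "(2 ^ k + i) XOR (2 ^ k + j) = (2 ^ k XOR 2 ^ k) XOR (i XOR j)"
    using assms by (simp only: two_power_add_eq_xor xor.assoc xor.left_commute)
  then show ?thesis by simp
qed

lemma xor_self_left [simp]: "i XOR (i XOR j) = (j :: nat)"
  by (simp flip: xor.assoc)

lemma xor_self_right [simp]: "(i XOR j) XOR j = (i :: nat)"
  by (simp add: xor.assoc)

lemma xor_self_left_commute [simp]: "i XOR (j XOR i) = (j :: nat)" "(i XOR j) XOR i = (j :: nat)"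
  by (simp_all add: ac_simps)

lemma xor_eq_0_iff [simp]: "i XOR j = 0 \<longleftrightarrow> i = (j :: nat)"
  by (metis xor_self_eq xor_self_left xor.right_neutral)

lemma xor_pos_iff [simp]: "0 < i XOR j \<longleftrightarrow> i \<noteq> (j :: nat)"
  using xor_eq_0_iff[of i j] by linarith

lemma xor_eq_left_iff [simp]: "i XOR j = i \<longleftrightarrow> j = (0::nat)" "i XOR j = j \<longleftrightarrow> i = (0::nat)"
  by (metis xor_self_left xor_self_eq xor.right_neutral xor.commute)+

lemma eq_xor_iff [simp]: "i = i XOR j \<longleftrightarrow> j = (0::nat)" "j = i XOR j \<longleftrightarrow> i = (0::nat)"
  by (metis xor_eq_left_iff)+

lemma xor_cancel [simp]: "i XOR k = j XOR k \<longleftrightarrow> i = (j :: nat)" "k XOR i = k XOR j \<longleftrightarrow> i = (j :: nat)"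
  by (metis xor_self_right xor_self_left)+

lemma two_power_cases:
  fixes i :: nat
  assumes "i < 2 ^ Suc k"
  obtains (low) "i < 2 ^ k" | (high) j where "j < 2 ^ k" "i = 2 ^ k + j"
proof (cases "i < 2 ^ k")
  case False
  then show thesis using assms high[of "i - 2 ^ k"] by auto
qed (use low in auto)

lemma two_power_cases2:
  fixes i j :: nat
  assumes "i < 2 ^ Suc k" "j < 2 ^ Suc k"
  obtains (low_low) "i < 2 ^ k" "j < 2 ^ k"
  | (low_high) b where "i < 2 ^ k" "b < 2 ^ k" "j = 2 ^ k + b"
  | (high_low) a where "a < 2 ^ k" "i = 2 ^ k + a" "j < 2 ^ k"
  | (high_high) a b where "a < 2 ^ k" "i = 2 ^ k + a" "b < 2 ^ k" "j = 2 ^ k + b"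
  using two_power_cases[OF assms(1)] two_power_cases[OF assms(2)] by metis

definition conj_sign :: "nat \<Rightarrow> real" where
  "conj_sign j = (if j = 0 then 1 else -1)"

text \<open>The structure constants of the standard basis. The four cases are the doubling formula
  evaluated on \<open>(a, 0) (c, 0)\<close>, \<open>(a, 0) (0, d)\<close>,
  \<open>(0, b) (c, 0)\<close> and \<open>(0, b) (0, d)\<close>; the link to the algebra is
  \<open>cd_mult_basis\<close>.\<close>

primrec basis_sign :: "(nat \<Rightarrow> real) \<Rightarrow> nat \<Rightarrow> nat \<Rightarrow> nat \<Rightarrow> real" where
  "basis_sign g 0 i j = 1"
| "basis_sign g (Suc k) i j =
     (if i < 2 ^ k then
        if j < 2 ^ k then basis_sign g k i j else basis_sign g k (j - 2 ^ k) i
      else if j < 2 ^ k then conj_sign j * basis_sign g k (i - 2 ^ k) j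
      else g k * conj_sign (j - 2 ^ k) * basis_sign g k (j - 2 ^ k) (i - 2 ^ k))"

text \<open>The coefficient of the unit in \<open>x * conj x\<close> for a basis element
  \<open>x\<close>, that is, the norm form on the basis.\<close>

definition norm_sign :: "(nat \<Rightarrow> real) \<Rightarrow> nat \<Rightarrow> nat \<Rightarrow> real" where
  "norm_sign g k i = conj_sign i * basis_sign g k i i"

lemma conj_sign_simps [simp]:
  "conj_sign 0 = 1" "j \<noteq> 0 \<Longrightarrow> conj_sign j = -1" "conj_sign j * conj_sign j = 1"
  by (auto simp: conj_sign_def)

lemma basis_sign_Suc [simp]:
  assumes "i < 2 ^ k" "j < 2 ^ k"
  shows "basis_sign g (Suc k) i j = basis_sign g k i j"
    and "basis_sign g (Suc k) i (2 ^ k + j) = basis_sign g k j i"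
    and "basis_sign g (Suc k) (2 ^ k + i) j = conj_sign j * basis_sign g k i j"
    and "basis_sign g (Suc k) (2 ^ k + i) (2 ^ k + j) = g k * conj_sign j * basis_sign g k j i"
  using assms by auto

declare basis_sign.simps(2) [simp del]

lemma basis_sign_unit [simp]:
  assumes "j < 2 ^ k"
  shows "basis_sign g k 0 j = 1" "basis_sign g k j 0 = 1"
proof -
  have "j < 2 ^ k \<Longrightarrow> basis_sign g k 0 j = 1 \<and> basis_sign g k j 0 = 1"
  proof (induction k arbitrary: j)
    case (Suc k)
    then show ?case
      by (elim two_power_cases) auto
  qed simp
  then show "basis_sign g k 0 j = 1" "basis_sign g k j 0 = 1" using assms by auto
qed

lemma basis_sign_top [simp]:
  assumes "j < 2 ^ k"
  shows "basis_sign g (Suc k) (2 ^ k) j = conj_sign j"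
    and "basis_sign g (Suc k) j (2 ^ k) = 1"
    and "basis_sign g (Suc k) (2 ^ k) (2 ^ k + j) = g k * conj_sign j"
    and "basis_sign g (Suc k) (2 ^ k + j) (2 ^ k) = g k"
    and "basis_sign g (Suc k) (2 ^ k) (2 ^ k) = g k"
  using assms basis_sign_Suc[of 0 k j g] basis_sign_Suc[of j k 0 g] basis_sign_Suc[of 0 k 0 g] by auto

lemma xor_top:
  fixes j :: nat
  assumes "j < 2 ^ k"
  shows "2 ^ k XOR j = 2 ^ k + j" "j XOR 2 ^ k = 2 ^ k + j"
    "2 ^ k XOR (2 ^ k + j) = j" "(2 ^ k + j) XOR 2 ^ k = j"
  using assms xor_high_low[of 0 k j] xor_high_low[of j k 0] xor_high_high[of 0 k j] xor_high_high[of j k 0]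
  by (auto simp: xor.commute)

locale cd_signs =
  fixes g :: "nat \<Rightarrow> real" and n :: nat
  assumes g_sign: "i \<le> n \<Longrightarrow> g i = 1 \<or> g i = -1"
begin

abbreviation sg :: "nat \<Rightarrow> nat \<Rightarrow> nat \<Rightarrow> real" where
  "sg \<equiv> basis_sign g"

abbreviation nm :: "nat \<Rightarrow> nat \<Rightarrow> real" where
  "nm \<equiv> norm_sign g"

lemma g_square [simp]: "i \<le> n \<Longrightarrow> g i * g i = 1"
  using g_sign[of i] by auto

lemma sg_sign:
  assumes "k \<le> Suc n" "i < 2 ^ k" "j < 2 ^ k"
  shows "sg k i j = 1 \<or> sg k i j = -1"
proof -
  have "\<bar>sg k i j\<bar> = 1"
    using assms
  proof (induction k arbitrary: i j)
    case (Suc k)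
    have "\<bar>g k\<bar> = 1" using Suc.prems g_sign[of k] by auto
    moreover have "\<bar>conj_sign a\<bar> = 1" for a by (simp add: conj_sign_def)
    ultimately show ?case
      using Suc.IH Suc.prems(1) by (rule_tac two_power_cases[OF Suc.prems(2)]; rule_tac two_power_cases[OF Suc.prems(3)]) (simp_all add: abs_mult)
  qed simp
  then show ?thesis by (simp add: abs_if split: if_splits)
qed

lemma sg_square [simp]:
  assumes "k \<le> Suc n" "i < 2 ^ k" "j < 2 ^ k"
  shows "sg k i j * sg k i j = 1"
  using sg_sign[OF assms] by auto

text \<open>When the two indices lie in different halves, the sign comes from the conjugation in the
  doubling formula alone; only indices in the same half use the induction hypothesis.\<close>

lemma sg_anticomm:
  assumes "i < 2 ^ k" "j < 2 ^ k" "i \<noteq> 0" "j \<noteq> 0" "i \<noteq> j"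
  shows "sg k j i = - sg k i j"
  using assms
proof (induction k arbitrary: i j)
  case (Suc k)
  from Suc.prems(1,2) show ?case
  proof (cases rule: two_power_cases2)
    case low_low
    then show ?thesis using Suc.prems(3-) Suc.IH[of i j] by simp
  next
    case (high_high a b)
    then show ?thesis using Suc.prems(3-) Suc.IH[of a b] by (cases "a = 0"; cases "b = 0") auto
  qed (use Suc.prems(3-) in simp_all)
qed simp

text \<open>Each doubling multiplies the norm by \<open>- g k\<close> on the upper half. So the norm
  is a homomorphism from the indices under xor to the signs, also at levels where the algebra itself
  is no longer a composition algebra.\<close>

lemma nm_xor:
  assumes "i < 2 ^ k" "j < 2 ^ k" "k \<le> Suc n"
  shows "nm k (i XOR j) = nm k i * nm k j"
  using assms
proof (induction k arbitrary: i j)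
  case 0
  then show ?case by (simp add: norm_sign_def)
next
  case (Suc k)
  have low: "nm (Suc k) a = nm k a" if "a < 2 ^ k" for a
    using that by (simp add: norm_sign_def)
  have high: "nm (Suc k) (2 ^ k + a) = - g k * nm k a" if "a < 2 ^ k" for a
    using that by (simp add: norm_sign_def)
  have gk: "g k * g k = 1" using Suc.prems by simp
  from Suc.prems(1,2) show ?case
    by (elim two_power_cases)
      (use Suc gk in \<open>simp_all add: low high xor_less_two_power xor_high_low xor_low_high xor_high_high\<close>)
qed

text \<open>These are the laws \<open>e_y (e_y e_i) = e_y^2 e_i\<close> and
  \<open>(e_i e_y) e_y = e_i e_y^2\<close>. They hold for basis elements at every level, although
  the algebra need not be alternative. If an index lies in the upper half, anticommutation reduces
  both to the left law one level lower.\<close>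

lemma sg_alternative:
  assumes "i < 2 ^ k" "y < 2 ^ k" "k \<le> Suc n"
  shows "sg k y i * sg k y (y XOR i) = sg k y y"
    and "sg k i y * sg k (y XOR i) y = sg k y y"
proof -
  have "sg k y i * sg k y (y XOR i) = sg k y y \<and> sg k i y * sg k (y XOR i) y = sg k y y"
    using assms
  proof (induction k arbitrary: i y)
    case (Suc k)
    have gk: "g k = 1 \<or> g k = -1" using Suc.prems g_sign by simp
    have ac: "sg k b a = - sg k a b" if "a < 2 ^ k" "b < 2 ^ k" "a \<noteq> 0" "b \<noteq> 0" "a \<noteq> b" for a b
      using that by (rule sg_anticomm)
    have IH: "sg k y i * sg k y (y XOR i) = sg k y y" "sg k i y * sg k (y XOR i) y = sg k y y"
      if "i < 2 ^ k" "y < 2 ^ k" for i y using Suc that by auto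
    from Suc.prems(1,2) show ?case
    proof (cases rule: two_power_cases2)
      case low_low
      then show ?thesis using Suc.prems Suc.IH by (simp add: xor_less_two_power)
    next
      case (low_high z)
      note lt = low_high(1,2)
      note xs = xor_less_two_power[OF lt(2,1)] and hl = xor_high_low[OF lt(2,1)]
      note eqs = low_high(3) hl
      show ?thesis
      proof (cases "z = 0 \<or> i = 0 \<or> z = i")
        case False
        have "sg k (z XOR i) z = - sg k z (z XOR i)" "sg k i z = - sg k z i"
          by (rule ac; use False lt xs in simp)+
        then show ?thesis using False lt xs IH(1)[OF lt, symmetric] gk unfolding eqs by auto
      qed (use lt xs in \<open>auto simp: eqs\<close>)
    next
      case (high_low j)
      note lt = high_low(1,3)
      note xs = xor_less_two_power[OF lt(2,1)] and hl = xor_low_high[OF lt(2,1)]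
      note eqs = high_low(2) hl
      show ?thesis
      proof (cases "y = 0 \<or> j = 0 \<or> y = j")
        case False
        have "sg k (y XOR j) y = - sg k y (y XOR j)" "sg k j y = - sg k y j"
          by (rule ac; use False lt xs in simp)+
        then show ?thesis using False lt xs IH(1)[OF lt, symmetric] gk unfolding eqs by auto
      qed (use lt xs in \<open>auto simp: eqs\<close>)
    next
      case (high_high j z)
      note lt = high_high(1,3)
      note xs = xor_less_two_power[OF lt(2,1)] and hl = xor_high_high[OF lt(2,1)]
      note eqs = high_high(2,4) hl
      show ?thesis
      proof (cases "z = 0 \<or> j = 0 \<or> z = j")
        case False
        have "sg k (z XOR j) z = - sg k z (z XOR j)" "sg k j z = - sg k z j"
          by (rule ac; use False lt xs in simp)+
        then show ?thesis using False lt xs IH(1)[OF lt, symmetric] gk unfolding eqs by auto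
      qed (use lt xs in \<open>auto simp: eqs\<close>)
    qed
  qed simp
  then show "sg k y i * sg k y (y XOR i) = sg k y y" "sg k i y * sg k (y XOR i) y = sg k y y"
    by auto
qed

end

section \<open>Compatible basis elements\<close>

text \<open>Linear independence over the field with two elements.\<close>

definition indep :: "nat \<Rightarrow> nat \<Rightarrow> nat \<Rightarrow> bool" where
  "indep y i j \<longleftrightarrow> y \<noteq> 0 \<and> i \<noteq> 0 \<and> j \<noteq> 0 \<and> i \<noteq> y \<and> j \<noteq> y \<and> i \<noteq> j \<and> j \<noteq> i XOR y"

lemma indep_sym: "indep y i j \<Longrightarrow> indep y j i"
  by (auto simp: indep_def xor.assoc)

context cd_signs begin

text \<open>The second component of \<open>(e\<^sub>i, s e\<^bsub>i xor y\<^esub>) (e\<^sub>j, t e\<^bsub>j xor y\<^esub>)\<close> vanishes iff \<open>s t\<close> is the sign \<open>eps\<close>.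
  If \<open>y\<close>, \<open>i\<close>, \<open>j\<close> are independent, the first component then vanishes too iff \<open>rho\<close> is \<open>\<gamma>\<^sub>n\<close>.\<close>

definition eps :: "nat \<Rightarrow> nat \<Rightarrow> nat \<Rightarrow> nat \<Rightarrow> real" where
  "eps k y i j = sg k (j XOR y) i * sg k (i XOR y) j"

definition rho :: "nat \<Rightarrow> nat \<Rightarrow> nat \<Rightarrow> nat \<Rightarrow> real" where
  "rho k y i j = eps k y i j * sg k i j * sg k (j XOR y) (i XOR y)"

lemma eps_sym: "eps k y i j = eps k y j i"
  by (simp add: eps_def)

lemma sign_mult:
  fixes a b :: real
  shows "a = 1 \<or> a = -1 \<Longrightarrow> b = 1 \<or> b = -1 \<Longrightarrow> a * b = 1 \<or> a * b = -1"
  by auto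

lemma eps_sign:
  assumes "k \<le> Suc n" "y < 2 ^ k" "i < 2 ^ k" "j < 2 ^ k"
  shows "eps k y i j = 1 \<or> eps k y i j = -1"
  unfolding eps_def using assms by (intro sign_mult sg_sign xor_less_two_power)

lemma nm_sign:
  assumes "k \<le> Suc n" "i < 2 ^ k"
  shows "nm k i = 1 \<or> nm k i = -1"
  unfolding norm_sign_def using assms by (intro sign_mult sg_sign) (auto simp: conj_sign_def)

lemma sg_diag: "i \<noteq> 0 \<Longrightarrow> sg k i i = - nm k i"
  by (simp add: norm_sign_def)

lemma nm_low: "i < 2 ^ k \<Longrightarrow> nm (Suc k) i = nm k i"
  by (simp add: norm_sign_def)

lemma nm_high: "i < 2 ^ k \<Longrightarrow> nm (Suc k) (2 ^ k + i) = - g k * nm k i"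
  by (simp add: norm_sign_def)

lemma nm_top: "nm (Suc k) (2 ^ k) = - g k"
  using basis_sign_top(5)[of 0 k g] by (simp add: norm_sign_def)

lemma sg_alternative':
  assumes "i < 2 ^ k" "y < 2 ^ k" "k \<le> Suc n"
  shows "sg k y i * sg k y (i XOR y) = sg k y y"
    and "sg k i y * sg k (i XOR y) y = sg k y y"
  using sg_alternative[OF assms] by (simp_all add: xor.commute)

text \<open>All signs involving the top index are \<open>1\<close> or come from conjugation; what
  remains is the left alternative law for \<open>y\<close> and \<open>i\<close>.\<close>

lemma rho_low_top:
  assumes "k \<le> n" "y < 2 ^ k" "y \<noteq> 0" "i < 2 ^ k" "i \<noteq> 0" "i \<noteq> y"
  shows "rho (Suc k) y i (2 ^ k) = - nm (Suc k) y"
  using assms sg_alternative'(1)[OF assms(4,2)]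
  by (simp add: rho_def eps_def xor_less_two_power xor_top sg_diag nm_low)

lemma eps_top:
  assumes "k \<le> n" "i < 2 ^ k" "j < 2 ^ k" "i \<noteq> 0" "j \<noteq> 0" "i \<noteq> j"
  shows "eps (Suc k) (2 ^ k) i j = -1"
    and "eps (Suc k) (2 ^ k) (2 ^ k + i) (2 ^ k + j) = -1"
    and "eps (Suc k) (2 ^ k) i (2 ^ k + j) = - g k"
    and "eps (Suc k) (2 ^ k) (2 ^ k + i) j = - g k"
  using assms sg_square[of k i j] sg_anticomm[OF assms(2-6)]
  by (simp_all add: eps_def xor_top)

text \<open>Xor with \<open>2 ^ k\<close> only moves an index to the other half. The lower-level
  signs therefore occur in equal pairs up to anticommutation and cancel, leaving
  \<open>g k\<close>.\<close>

lemma rho_top: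
  assumes "k \<le> n" "i < 2 ^ Suc k" "j < 2 ^ Suc k" "indep (2 ^ k) i j"
  shows "rho (Suc k) (2 ^ k) i j = g k"
  using assms(2,3)
proof (cases rule: two_power_cases2)
  case low_low
  then show ?thesis using assms(1,4) eps_top[of k i j] sg_square[of k i j]
    by (simp add: rho_def xor_top indep_def)
next
  case (low_high b)
  then show ?thesis using assms(1,4) eps_top[of k i b] sg_square[of k i b] sg_anticomm[of i k b]
    by (simp add: rho_def xor_top indep_def)
next
  case (high_low a)
  then show ?thesis using assms(1,4) eps_top[of k a j] sg_square[of k a j] sg_anticomm[of a k j]
    by (simp add: rho_def xor_top indep_def)
next
  case (high_high a b)
  then show ?thesis using assms(1,4) eps_top[of k a b] sg_square[of k a b] sg_anticomm[of a k b]
    by (simp add: rho_def xor_top indep_def)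
qed

text \<open>Here \<open>i XOR y\<close> is the top index, so that again the left alternative law
  decides.\<close>

lemma rho_high:
  assumes "k \<le> n" "z < 2 ^ k" "z \<noteq> 0" "j < 2 ^ k" "j \<noteq> 0" "j \<noteq> z"
  shows "rho (Suc k) (2 ^ k + z) z j = - nm (Suc k) (2 ^ k + z)"
proof -
  have "sg k (j XOR z) z = - sg k z (j XOR z)"
    using assms by (intro sg_anticomm xor_less_two_power) auto
  moreover have nmz: "nm k z = - (sg k z j * sg k z (j XOR z))"
    using sg_alternative'(1)[OF assms(4,2)] assms by (simp add: sg_diag)
  ultimately show ?thesis
    using assms nmz by (simp add: rho_def eps_def xor_less_two_power xor_low_high xor_top nm_high)
qed

text \<open>The factor \<open>g k\<close> comes from the only product of two upper indices,
  \<open>j XOR y\<close> and \<open>i XOR y\<close>; its conjugation sign cancels against reversing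
  the factors, and the two conjugation signs in \<open>eps\<close> cancel each other.\<close>

lemma rho_high_low:
  assumes "k \<le> n" "z < 2 ^ k" "i < 2 ^ k" "j < 2 ^ k" "indep z i j"
  shows "rho (Suc k) (2 ^ k + z) i j = g k * rho k z i j"
proof -
  have "sg k (j XOR z) (i XOR z) = - sg k (i XOR z) (j XOR z)"
    using assms by (intro sg_anticomm xor_less_two_power) (auto simp: indep_def)
  then show ?thesis
    using assms
    by (simp add: rho_def eps_def xor_less_two_power xor_low_high indep_def)
qed

section \<open>Independent pairs with a prescribed sign \<open>rho\<close>\<close>

lemma exists_outside:
  fixes a :: nat
  assumes "k \<ge> 2"
  obtains i where "i < 2 ^ k" "i \<noteq> 0" "i \<noteq> a"
proof -
  have "(4::nat) \<le> 2 ^ k" using power_increasing[OF assms, of "2::nat"] by simp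
  then have "(1::nat) < 2 ^ k" "(2::nat) < 2 ^ k" by auto
  then show thesis using that[of 1] that[of 2] by (cases "a = 1") auto
qed

lemma exists_indep:
  assumes "k \<ge> 3" "y < 2 ^ k" "y \<noteq> 0"
  obtains i j where "i < 2 ^ k" "j < 2 ^ k" "indep y i j"
proof -
  have card: "8 \<le> (2::nat) ^ k" using power_increasing[OF assms(1), of "2::nat"] by simp
  obtain i where i: "i < 2 ^ k" "i \<noteq> 0" "i \<noteq> y"
    using exists_outside[of k y] assms by auto
  have "card {0, y, i, i XOR y} \<le> 4"
    by (intro card_insert_le_m1) auto
  then have "\<not> {..<2 ^ k} \<subseteq> {0, y, i, i XOR y}"
    using card card_mono[of "{0, y, i, i XOR y}" "{..<2 ^ k}"] by auto
  then obtain j where "j < 2 ^ k" "j \<notin> {0, y, i, i XOR y}" by auto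
  then show thesis using that[of i j] i assms by (simp add: indep_def)
qed

text \<open>Excludes that every pair of a block with \<open>y \<noteq> 0\<close> is compatible,
  since that would require both \<open>nm\<close> and \<open>rho\<close> to equal
  \<open>g n\<close>. The witnesses are \<open>(i, 2 ^ k)\<close> for \<open>y\<close> in the lower
  half, a pair of lower indices for \<open>y = 2 ^ k\<close>, and \<open>(z, j)\<close> for any
  other \<open>y = 2 ^ k + z\<close>.\<close>

lemma exists_rho_minus_nm:
  assumes "Suc k \<le> n" "k \<ge> 2" "y < 2 ^ Suc k" "y \<noteq> 0"
  obtains i j where "i < 2 ^ Suc k" "j < 2 ^ Suc k" "indep y i j"
    "rho (Suc k) y i j = - nm (Suc k) y"
proof (rule two_power_cases[OF assms(3)])
  assume y: "y < 2 ^ k"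
  obtain i where i: "i < 2 ^ k" "i \<noteq> 0" "i \<noteq> y"
    using exists_outside[OF assms(2)] by metis
  have "i XOR y < 2 ^ k" using i y by (simp add: xor_less_two_power)
  then show thesis
    using i y assms rho_low_top[of k y i] by (intro that[of i "2 ^ k"]) (auto simp: indep_def)
next
  fix z assume z: "z < 2 ^ k" "y = 2 ^ k + z"
  show thesis
  proof (cases "z = 0")
    case True
    obtain i :: nat where i: "i < 2 ^ k" "i \<noteq> 0" using exists_outside[OF assms(2), of 0] by metis
    obtain j where j: "j < 2 ^ k" "j \<noteq> 0" "j \<noteq> i" using exists_outside[OF assms(2), of i] by metis
    have "indep (2 ^ k) i j" using i j by (auto simp: indep_def xor_top)
    then show thesis
      using i j z True assms rho_top[of k i j] by (intro that[of i j]) (auto simp: nm_top)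
  next
    case False
    obtain j where j: "j < 2 ^ k" "j \<noteq> 0" "j \<noteq> z" using exists_outside[OF assms(2)] by metis
    have "indep y z j" using j z False by (auto simp: indep_def xor_low_high)
    then show thesis
      using j z False assms rho_high[of k z j] by (intro that[of z j]) auto
  qed
qed

text \<open>Passing from \<open>z\<close> to \<open>2 ^ Suc k + z\<close> multiplies
  \<open>rho\<close> by \<open>g (Suc k)\<close> but \<open>nm\<close> by
  \<open>- g (Suc k)\<close>, which turns a pair with \<open>rho = - nm\<close> into one with
  \<open>rho = nm\<close>.\<close>

lemma exists_rho_nm:
  assumes "Suc (Suc k) \<le> n" "k \<ge> 2" "z < 2 ^ Suc k" "z \<noteq> 0"
  obtains i j where "i < 2 ^ Suc k" "j < 2 ^ Suc k" "indep (2 ^ Suc k + z) i j"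
    "rho (Suc (Suc k)) (2 ^ Suc k + z) i j = nm (Suc (Suc k)) (2 ^ Suc k + z)"
proof -
  obtain i j where ij: "i < 2 ^ Suc k" "j < 2 ^ Suc k" "indep z i j"
      "rho (Suc k) z i j = - nm (Suc k) z"
    using exists_rho_minus_nm[of k z] assms by auto
  have "indep (2 ^ Suc k + z) i j"
    using ij assms xor_low_high[OF ij(1) assms(3)] by (auto simp: indep_def)
  then show thesis
    using ij assms rho_high_low[of "Suc k" z i j] by (intro that[of i j]) (simp_all add: nm_high del: power_Suc)
qed

text \<open>For independent \<open>i\<close>, \<open>j\<close> in the lower half, the triangle
  \<open>i\<close>, \<open>j\<close>, \<open>2 ^ k + j\<close> works: the two signs at
  \<open>i\<close> agree and the third sign is \<open>1\<close>.\<close>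

lemma exists_positive_triangle:
  assumes "k \<le> n" "k \<ge> 3" "y < 2 ^ k" "y \<noteq> 0"
  obtains a b c where "a < 2 ^ Suc k" "b < 2 ^ Suc k" "c < 2 ^ Suc k"
    "indep y a b" "indep y b c" "indep y a c"
    "eps (Suc k) y a b * eps (Suc k) y b c * eps (Suc k) y a c = 1"
proof -
  obtain i j where ij: "i < 2 ^ k" "j < 2 ^ k" "indep y i j"
    using exists_indep[OF assms(2-)] by metis
  have lt: "i XOR y < 2 ^ k" "j XOR y < 2 ^ k" using ij assms by (simp_all add: xor_less_two_power)
  have 1: "sg k j (i XOR y) = - sg k (i XOR y) j" "sg k j (j XOR y) = - sg k (j XOR y) j"
    using lt ij assms(4) by (intro sg_anticomm; simp add: indep_def)+
  have "eps (Suc k) y i (2 ^ k + j) = eps (Suc k) y i j"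
    using ij lt 1 assms by (simp add: eps_def indep_def xor_high_low)
  moreover have "eps (Suc k) y j (2 ^ k + j) = 1"
    using ij lt 1 assms sg_square[of k "j XOR y" j] by (simp add: eps_def indep_def xor_high_low)
  moreover have "eps (Suc k) y i j * eps (Suc k) y i j = 1"
    using eps_sign[of "Suc k" y i j] ij assms by auto
  ultimately show thesis
    using ij lt assms by (intro that[of i j "2 ^ k + j"]) (auto simp: indep_def)
qed

end

section \<open>Local invariants of the blocks\<close>

definition neighbours :: "('a \<Rightarrow> 'a \<Rightarrow> bool) \<Rightarrow> 'a \<Rightarrow> 'a set" where
  "neighbours E u = {v. E u v}"

definition locally_regular :: "('a \<Rightarrow> 'a \<Rightarrow> bool) \<Rightarrow> nat \<Rightarrow> 'a \<Rightarrow> bool" where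
  "locally_regular E d u \<longleftrightarrow>
     card (neighbours E u) = d \<and> (\<forall>v. E u v \<longrightarrow> card (neighbours E v) = d)"

definition in_triangle :: "('a \<Rightarrow> 'a \<Rightarrow> bool) \<Rightarrow> 'a \<Rightarrow> bool" where
  "in_triangle E u \<longleftrightarrow> (\<exists>v w. E u v \<and> E v w \<and> E w u)"

text \<open>The positions of \<open>i\<close> and \<open>j\<close> relative to \<open>y\<close> that
  have separate compatibility criteria below: \<open>g n = 1\<close> for \<open>y = 0\<close>,
  \<open>nm n y = g n\<close> in the three dependent positions, and \<open>rho n y i j = g n\<close>
  for independent indices.\<close>

lemma index_cases:
  fixes y i j :: nat
  obtains (zero) "y = 0" | (left) "i = y" | (right) "j = y" | (pair) "j = i XOR y" | (indep) "indep y i j"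
    | (degenerate) "i = 0 \<or> j = 0 \<or> i = j"
  unfolding indep_def by metis

context cd_signs begin

text \<open>The condition, free of \<open>s\<close> and \<open>t\<close>, for the first component of
  the product to vanish once the second one does. The factor \<open>conj_sign (j XOR y)\<close> is
  \<open>1\<close> only for \<open>j = y\<close>, which hides the symmetry in \<open>i\<close> and
  \<open>j\<close>.\<close>

definition compat :: "nat \<Rightarrow> nat \<Rightarrow> nat \<Rightarrow> bool" where
  "compat y i j \<longleftrightarrow> i \<noteq> 0 \<and> j \<noteq> 0 \<and> i \<noteq> j \<and> i < 2 ^ n \<and> j < 2 ^ n \<and> y < 2 ^ n \<and>
     eps n y i j = - g n * conj_sign (j XOR y) * sg n i j * sg n (j XOR y) (i XOR y)"

text \<open>The triple \<open>(y, i, s)\<close> stands for the line spanned by \<open>(e\<^sub>i, s e\<^bsub>i xor y\<^esub>)\<close>.\<close>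

fun adj :: "nat \<times> nat \<times> real \<Rightarrow> nat \<times> nat \<times> real \<Rightarrow> bool" where
  "adj (y, i, s) (y', j, t) \<longleftrightarrow>
     y' = y \<and> compat y i j \<and> (s = 1 \<or> s = -1) \<and> t = s * eps n y i j"

section \<open>Compatibility according to the position of the indices relative to
  \<open>y\<close>\<close>

lemma compat_zero:
  assumes "i \<noteq> 0" "j \<noteq> 0" "i \<noteq> j" "i < 2 ^ n" "j < 2 ^ n"
  shows "compat 0 i j \<longleftrightarrow> g n = 1"
  using assms sg_anticomm[of i n j] sg_sign[of n i j] by (auto simp: compat_def eps_def)

lemma sg_nm_right:
  assumes "y < 2 ^ n" "y \<noteq> 0" "i < 2 ^ n"
  shows "sg n (i XOR y) y = - nm n y * sg n i y"
  using sg_alternative'(2)[OF assms(3,1)] assms sg_sign[of n i y] by (auto simp: sg_diag)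

text \<open>The index \<open>y\<close> is the hub of its block: its lines are spanned by
  \<open>(e_y, t e_0)\<close>, whose second component is the unit up to sign. The right alternative
  law brings in the norm of \<open>y\<close>.\<close>

lemma compat_hub_right:
  assumes "y < 2 ^ n" "y \<noteq> 0" "i < 2 ^ n" "i \<noteq> 0" "i \<noteq> y"
  shows "compat y i y \<longleftrightarrow> nm n y = g n"
  using assms sg_sign[of n i y] by (auto simp: compat_def eps_def sg_nm_right xor_less_two_power)

lemma compat_hub_left:
  assumes "y < 2 ^ n" "y \<noteq> 0" "i < 2 ^ n" "i \<noteq> 0" "i \<noteq> y"
  shows "compat y y i \<longleftrightarrow> nm n y = g n"
  using assms sg_sign[of n i y] sg_anticomm[of i n y]
  by (auto simp: compat_def eps_def sg_nm_right xor_less_two_power)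

text \<open>The two factors are the signs of the squares of \<open>e_i\<close> and
  \<open>e_(i XOR y)\<close>, so multiplicativity of the norm applies.\<close>

lemma eps_pair:
  assumes "y < 2 ^ n" "y \<noteq> 0" "i < 2 ^ n" "i \<noteq> 0" "i \<noteq> y"
  shows "eps n y i (i XOR y) = nm n y"
  using assms nm_xor[of i n "i XOR y"] by (simp add: eps_def sg_diag xor_less_two_power)

lemma compat_pair:
  assumes "y < 2 ^ n" "y \<noteq> 0" "i < 2 ^ n" "i \<noteq> 0" "i \<noteq> y"
  shows "compat y i (i XOR y) \<longleftrightarrow> nm n y = g n"
  using assms sg_square[of n i "i XOR y"]
  by (auto simp: compat_def eps_pair xor_less_two_power mult.assoc)

lemma compat_indep:
  assumes "y < 2 ^ n" "i < 2 ^ n" "j < 2 ^ n" "indep y i j"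
  shows "compat y i j \<longleftrightarrow> rho n y i j = g n"
proof -
  have "sg n i j = 1 \<or> sg n i j = -1" "sg n (j XOR y) (i XOR y) = 1 \<or> sg n (j XOR y) (i XOR y) = -1"
    using assms by (simp_all add: sg_sign xor_less_two_power)
  then show ?thesis
    using assms by (auto simp: compat_def rho_def indep_def)
qed

lemma rho_sym:
  assumes "y < 2 ^ n" "i < 2 ^ n" "j < 2 ^ n" "indep y i j"
  shows "rho n y j i = rho n y i j"
proof -
  have "sg n j i = - sg n i j" "sg n (i XOR y) (j XOR y) = - sg n (j XOR y) (i XOR y)"
    using assms by (auto simp: indep_def intro!: sg_anticomm xor_less_two_power)
  then show ?thesis by (simp add: rho_def eps_sym)
qed

text \<open>Each criterion is symmetric in \<open>i\<close> and \<open>j\<close>: the two hub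
  positions share one, and for independent indices the swap changes two signs in
  \<open>rho\<close>.\<close>

lemma compat_sym: "compat y i j \<Longrightarrow> compat y j i"
proof -
  assume c: "compat y i j"
  then have r: "i \<noteq> 0" "j \<noteq> 0" "i \<noteq> j" "i < 2 ^ n" "j < 2 ^ n" "y < 2 ^ n"
    by (auto simp: compat_def)
  show "compat y j i"
  proof (cases rule: index_cases[where y = y and i = i and j = j])
    case zero
    then show ?thesis using c r compat_zero[of i j] compat_zero[of j i] by auto
  next
    case left
    then show ?thesis using c r compat_hub_left[of y j] compat_hub_right[of y j] by auto
  next
    case right
    then show ?thesis using c r compat_hub_left[of y i] compat_hub_right[of y i] by auto
  next
    case pair
    have "y \<noteq> 0" using pair r by auto
    show ?thesis
    proof (cases "i = y")
      case True
      then show ?thesis using pair r by auto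
    next
      case False
      then show ?thesis
        using c r pair \<open>y \<noteq> 0\<close> compat_pair[of y i] compat_pair[of y j] by auto
    qed
  next
    case indep
    then show ?thesis using c r compat_indep[of y i j] compat_indep[of y j i] rho_sym indep_sym by auto
  next
    case degenerate
    then show ?thesis using r by auto
  qed
qed

lemma adj_sym: "adj u v \<Longrightarrow> adj v u"
proof (cases u; cases v)
  fix y i s y' j t assume "adj u v" and [simp]: "u = (y, i, s)" "v = (y', j, t)"
  then have "y' = y" "compat y i j" "s = 1 \<or> s = -1" "t = s * eps n y i j" by auto
  moreover have "eps n y i j = 1 \<or> eps n y i j = -1"
    using \<open>compat y i j\<close> by (intro eps_sign) (auto simp: compat_def)
  ultimately show "adj v u" using compat_sym by (auto simp: eps_sym[of n y j i])
qed

section \<open>Degrees of the vertices\<close>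

lemma neighbours_adj:
  assumes "s = 1 \<or> s = -1"
  shows "neighbours adj (y, i, s) = (\<lambda>j. (y, j, s * eps n y i j)) ` {j. compat y i j}"
  using assms by (auto simp: neighbours_def)

lemma finite_compat [simp]: "finite {j. compat y i j}"
  by (rule finite_subset[of _ "{..<2 ^ n}"]) (auto simp: compat_def)

lemma card_neighbours_adj:
  assumes "s = 1 \<or> s = -1"
  shows "card (neighbours adj (y, i, s)) = card {j. compat y i j}"
  unfolding neighbours_adj[OF assms] by (intro card_image inj_onI) auto

text \<open>Adjacency contains the range conditions, so a triple that is not isolated is
  automatically an admissible index. Degrees can thus be studied without a vertex set.\<close>

lemma card_neighbours_pos:
  assumes "card (neighbours adj (y, i, s)) > 0"
  shows "y < 2 ^ n" "i < 2 ^ n" "i \<noteq> 0" "s = 1 \<or> s = -1"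
proof -
  obtain v where "adj (y, i, s) v"
    using assms by (metis card_gt_0_iff neighbours_def ex_in_conv mem_Collect_eq)
  then show "y < 2 ^ n" "i < 2 ^ n" "i \<noteq> 0" "s = 1 \<or> s = -1"
    by (cases v; auto simp: compat_def)+
qed

lemma compat_subset: "{j. compat y i j} \<subseteq> {..<2 ^ n} - {0, i}"
  by (auto simp: compat_def)

lemma card_minus_two:
  fixes i :: nat
  assumes "i < 2 ^ n" "i \<noteq> 0"
  shows "card ({..<2 ^ n} - {0, i}) = 2 ^ n - 2"
  using assms by (subst card_Diff_subset) auto

lemma compat_of_full_degree:
  assumes "card {j. compat y i j} = 2 ^ n - 2" "i < 2 ^ n" "i \<noteq> 0"
  shows "{j. compat y i j} = {..<2 ^ n} - {0, i}"
  using assms by (intro card_subset_eq compat_subset) (simp_all add: card_minus_two)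

lemma card_compat_hub:
  assumes "y < 2 ^ n" "y \<noteq> 0" "nm n y = g n"
  shows "card {j. compat y y j} = 2 ^ n - 2"
proof -
  have "{j. compat y y j} = {..<2 ^ n} - {0, y}"
    using assms compat_subset[of y y] compat_hub_left[of y] by auto
  then show ?thesis using assms by (simp add: card_minus_two)
qed

text \<open>All three dependent positions have the same criterion \<open>nm n y = g n\<close>; when
  it fails, they drop out together.\<close>

lemma compat_subset_four:
  assumes "y < 2 ^ n" "y \<noteq> 0" "nm n y \<noteq> g n"
  shows "{j. compat y i j} \<subseteq> {..<2 ^ n} - {0, y, i, i XOR y}"
proof
  fix j assume "j \<in> {j. compat y i j}"
  then have c: "compat y i j" by simp
  then have r: "i \<noteq> 0" "j \<noteq> 0" "i \<noteq> j" "i < 2 ^ n" "j < 2 ^ n" by (auto simp: compat_def)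
  then show "j \<in> {..<2 ^ n} - {0, y, i, i XOR y}"
    using c assms compat_hub_right[of y i] compat_pair[of y i] by auto
qed

lemma not_compat_hub:
  assumes "y < 2 ^ n" "y \<noteq> 0" "nm n y \<noteq> g n"
  shows "{j. compat y y j} = {}"
proof -
  have "\<not> compat y y j" for j
    using assms compat_hub_left[of y j] by (auto simp: compat_def)
  then show ?thesis by auto
qed

lemma card_minus_four:
  fixes i y :: nat
  assumes "y < 2 ^ n" "y \<noteq> 0" "i < 2 ^ n" "i \<noteq> 0" "i \<noteq> y"
  shows "card ({..<2 ^ n} - {0, y, i, i XOR y}) = 2 ^ n - 4"
proof -
  have "i XOR y < 2 ^ n" using assms by (simp add: xor_less_two_power)
  moreover have "card {0, y, i, i XOR y} = 4" using assms by simp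
  ultimately show ?thesis using assms by (subst card_Diff_subset) auto
qed

lemma power_bounds: "n \<ge> 3 \<Longrightarrow> (2::nat) ^ n \<ge> 8" "n \<ge> 4 \<Longrightarrow> (2::nat) ^ n \<ge> 16"
  using power_increasing[of 3 n "2::nat"] power_increasing[of 4 n "2::nat"] by auto

text \<open>If a vertex and all its neighbours have full degree, every pair of indices of the block
  is compatible. For \<open>y \<noteq> 0\<close> this gives \<open>nm n y = g n\<close> through the
  hub and \<open>rho = g n\<close> on all independent pairs, against the pair with
  \<open>rho = - nm\<close>.\<close>

lemma locally_regular_full:
  assumes "n \<ge> 3"
  shows "{u. locally_regular adj (2 ^ n - 2) u} =
    (if g n = 1 then {0} \<times> ({..<2 ^ n} - {0}) \<times> {1, -1} else {})"
proof -
  have pos: "(2::nat) ^ n - 2 > 0" using power_bounds(1)[OF assms] by simp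
  have zero: "y = 0 \<and> g n = 1" if lr: "locally_regular adj (2 ^ n - 2) (y, i, s)" for y i s
  proof -
    have d: "card (neighbours adj (y, i, s)) = 2 ^ n - 2"
      using lr by (simp add: locally_regular_def)
    note r = card_neighbours_pos[of y i s, unfolded d, OF pos]
    have ci: "{j. compat y i j} = {..<2 ^ n} - {0, i}"
      using d r by (intro compat_of_full_degree) (simp_all add: card_neighbours_adj)
    have all: "compat y a b" if "a < 2 ^ n" "b < 2 ^ n" "a \<noteq> 0" "b \<noteq> 0" "a \<noteq> b" for a b
    proof (cases "a = i")
      case True
      then show ?thesis using ci that by auto
    next
      case False
      then have c: "compat y i a" using ci that by auto
      have "adj (y, i, s) (y, a, s * eps n y i a)" using c r by auto
      then have "card (neighbours adj (y, a, s * eps n y i a)) = 2 ^ n - 2"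
        using lr by (simp add: locally_regular_def)
      moreover have "s * eps n y i a = 1 \<or> s * eps n y i a = -1"
        using r that by (intro sign_mult eps_sign) auto
      ultimately have "{j. compat y a j} = {..<2 ^ n} - {0, a}"
        using that by (intro compat_of_full_degree) (simp_all add: card_neighbours_adj)
      then show ?thesis using that by auto
    qed
    have "y = 0"
    proof (rule ccontr)
      assume y: "y \<noteq> 0"
      obtain k where k: "n = Suc k" using assms by (cases n) auto
      obtain a b where ab: "a < 2 ^ n" "b < 2 ^ n" "indep y a b" "rho n y a b = - nm n y"
        using exists_rho_minus_nm[of k y] r y assms k by auto
      have "compat y a b" using ab by (intro all) (auto simp: indep_def)
      then have "rho n y a b = g n" using compat_indep ab r by simp
      moreover have "compat y y a" using ab r y by (intro all) (auto simp: indep_def)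
      then have "nm n y = g n" using compat_hub_left[of y a] ab r y by (auto simp: indep_def)
      ultimately show False using ab g_sign[of n] by auto
    qed
    moreover obtain j where "j < 2 ^ n" "j \<noteq> 0" "j \<noteq> i" using exists_outside[of n i] assms by auto
    then have "g n = 1"
      using all[of i j] compat_zero[of i j] r \<open>y = 0\<close> by auto
    ultimately show ?thesis by simp
  qed
  have "locally_regular adj (2 ^ n - 2) (0, i, s)"
    if "g n = 1" "i < 2 ^ n" "i \<noteq> 0" "s = 1 \<or> s = -1" for i s
  proof -
    have "card (neighbours adj (0, a, t)) = 2 ^ n - 2"
      if "a < 2 ^ n" "a \<noteq> 0" "t = 1 \<or> t = -1" for a t
    proof -
      have "{j. compat 0 a j} = {..<2 ^ n} - {0, a}"
        using compat_subset[of 0 a] compat_zero[of a] \<open>g n = 1\<close> that by auto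
      then show ?thesis using that by (simp add: card_neighbours_adj card_minus_two)
    qed
    note full = this
    have "card (neighbours adj v) = 2 ^ n - 2" if "adj (0, i, s) v" for v
    proof (cases v)
      case (fields y a t)
      then show ?thesis
        using that full[of a t] eps_sign[of n 0 i a] by (auto simp: compat_def)
    qed
    then show ?thesis using full that by (auto simp: locally_regular_def simp del: adj.simps)
  qed
  note one = this
  show ?thesis (is "?L = ?R")
  proof (intro equalityI subsetI)
    fix u assume "u \<in> ?L"
    moreover obtain y i s where u: "u = (y, i, s)" by (cases u)
    ultimately have lr: "locally_regular adj (2 ^ n - 2) (y, i, s)" by simp
    then have "card (neighbours adj (y, i, s)) > 0" using pos by (simp add: locally_regular_def)
    from card_neighbours_pos[OF this] zero[OF lr] show "u \<in> ?R" using u by auto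
  next
    fix u assume "u \<in> ?R"
    then show "u \<in> ?L" using one by (auto split: if_splits)
  qed
qed

end

declare One_nat_def [simp del]

section \<open>Blocks of degree \<open>2 ^ n - 4\<close> and the block of
  \<open>(0, 1)\<close>\<close>

context cd_signs begin

text \<open>The index of \<open>(0, 1)\<close> in the \<open>n\<close>-th algebra when
  \<open>n > 0\<close>.\<close>

abbreviation top :: nat where
  "top \<equiv> 2 ^ (n - 1)"

lemma top_bounds:
  assumes "n \<ge> 3"
  shows "top < 2 ^ n" "top \<noteq> 0" "nm n top = - g (n - 1)"
  using assms nm_top[of "n - 1"] by (simp_all add: power_strict_increasing)

text \<open>Going round a triangle of indices multiplies the sign \<open>t\<close> by the product of
  the three \<open>eps\<close>, so the lifted path closes iff that product is
  \<open>1\<close>.\<close>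

lemma in_triangleI:
  assumes "compat y a b" "compat y b c" "compat y a c" "t = 1 \<or> t = -1"
    and "eps n y a b * eps n y b c * eps n y a c = 1"
  shows "in_triangle adj (y, a, t)"
proof -
  have r: "a < 2 ^ n" "b < 2 ^ n" "c < 2 ^ n" "y < 2 ^ n" using assms by (auto simp: compat_def)
  then have e: "eps n y a b = 1 \<or> eps n y a b = -1" "eps n y b c = 1 \<or> eps n y b c = -1"
    by (simp_all add: eps_sign)
  have "adj (y, a, t) (y, b, t * eps n y a b)" using assms by auto
  moreover have "adj (y, b, t * eps n y a b) (y, c, t * eps n y a b * eps n y b c)"
    using assms e by auto
  moreover have "adj (y, c, t * eps n y a b * eps n y b c) (y, a, t)"
    using assms e compat_sym eps_sym[of n y c a] by auto
  ultimately show ?thesis unfolding in_triangle_def by blast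
qed

text \<open>The degree excludes \<open>y = 0\<close>, where it is \<open>0\<close> or
  \<open>2 ^ n - 2\<close>, and also \<open>nm n y = g n\<close>, where the hub has full degree and
  is the vertex itself or a neighbour. In the remaining case \<open>2 ^ n - 4\<close> is the
  maximum, so the index of the vertex and those of its neighbours are compatible with every index
  independent of them.\<close>

lemma locally_regular_minus_fourD:
  assumes n: "n \<ge> 4" and lr: "locally_regular adj (2 ^ n - 4) (y, i, s)"
  shows "y < 2 ^ n" "i < 2 ^ n" "i \<noteq> 0" "s = 1 \<or> s = -1" "y \<noteq> 0" "i \<noteq> y" "nm n y = - g n"
    and "\<And>a b. a < 2 ^ n \<Longrightarrow> b < 2 ^ n \<Longrightarrow> indep y a b \<Longrightarrow> compat y a b"
proof -
  have pos: "(2::nat) ^ n - 4 > 0" "(2::nat) ^ n - 2 \<noteq> 2 ^ n - 4" using power_bounds(2)[OF n] by simp_all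
  have d: "card (neighbours adj (y, i, s)) = 2 ^ n - 4"
    using lr by (simp add: locally_regular_def)
  show r: "y < 2 ^ n" "i < 2 ^ n" "i \<noteq> 0" "s = 1 \<or> s = -1"
    using card_neighbours_pos[of y i s] d pos by auto
  have ci: "card {j. compat y i j} = 2 ^ n - 4"
    using d r by (simp add: card_neighbours_adj)
  have nb: "card {j. compat y a j} = 2 ^ n - 4" if "compat y i a" for a
  proof -
    have "s * eps n y i a = 1 \<or> s * eps n y i a = -1"
      using r that by (intro sign_mult eps_sign) (auto simp: compat_def)
    moreover have "adj (y, i, s) (y, a, s * eps n y i a)" using r that by simp
    ultimately show ?thesis
      using lr card_neighbours_adj[of "s * eps n y i a" y a] by (auto simp: locally_regular_def)
  qed
  show y: "y \<noteq> 0"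
  proof
    assume y0: "y = 0"
    have "{j. compat y i j} \<noteq> {}" using ci pos by (metis card.empty less_irrefl)
    then have "g n = 1" using compat_zero[of i] r y0 by (auto simp: compat_def)
    then have "{j. compat y i j} = {..<2 ^ n} - {0, i}"
      using compat_subset[of y i] compat_zero[of i] r y0 by auto
    then show False using ci pos r by (simp add: card_minus_two)
  qed
  have "nm n y \<noteq> g n"
  proof
    assume nm: "nm n y = g n"
    have hub: "card {j. compat y y j} = 2 ^ n - 2" using nm r y by (intro card_compat_hub)
    show False
    proof (cases "i = y")
      case True
      then show False using hub ci pos by simp
    next
      case False
      then have "compat y i y" using compat_hub_right r y nm by simp
      then show False using hub nb pos by simp
    qed
  qed
  then show nm: "nm n y = - g n"
    using nm_sign[of n y] g_sign[of n] r by auto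
  show iy: "i \<noteq> y"
    using not_compat_hub[of y] \<open>nm n y \<noteq> g n\<close> r y ci pos by auto
  have full: "{j. compat y a j} = {..<2 ^ n} - {0, y, a, a XOR y}"
    if "a < 2 ^ n" "a \<noteq> 0" "a \<noteq> y" "card {j. compat y a j} = 2 ^ n - 4" for a
  proof (rule card_subset_eq)
    show "card {j. compat y a j} = card ({..<2 ^ n} - {0, y, a, a XOR y})"
      unfolding that(4) using that r y by (intro card_minus_four[symmetric])
  qed (use compat_subset_four r y \<open>nm n y \<noteq> g n\<close> in auto)
  have fi: "{j. compat y i j} = {..<2 ^ n} - {0, y, i, i XOR y}"
    using r y iy ci by (intro full)
  have other: "compat y a b"
    if "a < 2 ^ n" "b < 2 ^ n" "indep y a b" "a \<noteq> i" "a \<noteq> i XOR y" for a b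
  proof -
    have "compat y i a" using fi that by (auto simp: indep_def)
    then have "{j. compat y a j} = {..<2 ^ n} - {0, y, a, a XOR y}"
      using that by (intro full nb) (auto simp: indep_def)
    then show ?thesis using that by (auto simp: indep_def)
  qed
  show "compat y a b" if ab: "a < 2 ^ n" "b < 2 ^ n" "indep y a b" for a b
  proof (cases "a = i \<or> a = i XOR y")
    case False
    then show ?thesis using other ab by simp
  next
    \<comment> \<open>The indices \<open>i\<close> and \<open>i XOR y\<close> are incompatible, so
      nothing is known directly about the degree at \<open>i XOR y\<close>. But \<open>b\<close> is
      now a neighbour of \<open>i\<close>, and symmetry gives the claim.\<close>
    case True
    then have "b \<noteq> i" "b \<noteq> i XOR y" using ab by (auto simp: indep_def)
    then show ?thesis using other[of b a] ab indep_sym compat_sym by blast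
  qed
qed

definition top_sign :: "nat \<Rightarrow> real" where
  "top_sign i = (if i < top then 1 else g (n - 1))"

text \<open>Splitting \<open>eps\<close> into contributions of the two indices makes its product
  round any triangle of independent pairs equal to \<open>-1\<close>, so that no such triangle lifts
  to a triangle of vertices.\<close>

lemma eps_top_indep:
  assumes "n \<ge> 3" "i < 2 ^ n" "j < 2 ^ n" "indep top i j"
  shows "eps n top i j = - top_sign i * top_sign j"
proof -
  obtain k where k: "n = Suc k" using assms by (cases n) auto
  have gk: "g k * g k = 1" using k by simp
  have "i < 2 ^ Suc k" "j < 2 ^ Suc k" "indep (2 ^ k) i j" using assms k by simp_all
  then have "eps (Suc k) (2 ^ k) i j = - (if i < 2 ^ k then 1 else g k) * (if j < 2 ^ k then 1 else g k)"
  proof (cases rule: two_power_cases2)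
    case low_low
    then show ?thesis using eps_top(1)[of k i j] \<open>indep (2 ^ k) i j\<close> k by (auto simp: indep_def)
  next
    case (low_high b)
    then show ?thesis using eps_top(3)[of k i b] \<open>indep (2 ^ k) i j\<close> k by (auto simp: indep_def xor_top)
  next
    case (high_low a)
    then show ?thesis using eps_top(4)[of k a j] \<open>indep (2 ^ k) i j\<close> k by (auto simp: indep_def xor_top)
  next
    case (high_high a b)
    then show ?thesis using eps_top(2)[of k a b] \<open>indep (2 ^ k) i j\<close> k gk by (auto simp: indep_def xor_top)
  qed
  then show ?thesis unfolding top_sign_def unfolding k by simp
qed

lemma eps_top_hub:
  assumes "n \<ge> 3" "i < 2 ^ n" "i \<noteq> 0" "i \<noteq> top"
  shows "eps n top i top = (if i < top then g (n - 1) else 1)"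
proof -
  obtain k where k: "n = Suc k" using assms by (cases n) auto
  have "i < 2 ^ Suc k" using assms k by simp
  then have "eps (Suc k) (2 ^ k) i (2 ^ k) = (if i < 2 ^ k then g k else 1)"
    by (cases rule: two_power_cases) (auto simp: eps_def xor_top)
  then show ?thesis unfolding k by simp
qed

text \<open>Here \<open>nm\<close> is \<open>- g (n - 1)\<close> and \<open>rho\<close> is
  constantly \<open>g (n - 1)\<close>. So either exactly the dependent or exactly the independent
  pairs are compatible, and the lower parameters do not enter.\<close>

lemma compat_top:
  assumes n: "n \<ge> 3"
  shows "compat top i j \<longleftrightarrow> i \<noteq> 0 \<and> j \<noteq> 0 \<and> i \<noteq> j \<and> i < 2 ^ n \<and> j < 2 ^ n \<and>
    g n = (if i = top \<or> j = top \<or> j = i XOR top then - g (n - 1) else g (n - 1))"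
proof (cases "i \<noteq> 0 \<and> j \<noteq> 0 \<and> i \<noteq> j \<and> i < 2 ^ n \<and> j < 2 ^ n")
  case False
  then show ?thesis by (auto simp: compat_def)
next
  case True
  obtain k where k: "n = Suc k" using assms by (cases n) auto
  note t = top_bounds[OF n]
  show ?thesis
  proof (cases "i = top \<or> j = top \<or> j = i XOR top")
    case dep: True
    then show ?thesis
      using True t compat_hub_left[of top j] compat_hub_right[of top i] compat_pair[of top i]
      by auto
  next
    case False
    then have ind: "indep top i j" using True t by (auto simp: indep_def)
    have "rho n top i j = g (n - 1)" using rho_top[of k i j] True ind k by simp
    then show ?thesis using compat_indep[of top i j] True t ind False by auto
  qed
qed

text \<open>A block with \<open>y\<close> below \<open>top\<close> contains a positive triangle, and
  one above \<open>top\<close> contains an independent pair with \<open>rho = nm\<close>, which is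
  incompatible when \<open>nm = - g n\<close>. In the top block the hub is isolated if
  \<open>g (n - 1) = g n\<close>, hence its absence on the right-hand side.\<close>

lemma locally_regular_triangle_free:
  assumes n: "n \<ge> 4"
  shows "{u. locally_regular adj (2 ^ n - 4) u \<and> (\<forall>v. adj u v \<longrightarrow> \<not> in_triangle adj v)} =
    (if g (n - 1) = g n then {top} \<times> ({..<2 ^ n} - {0, top}) \<times> {1, -1} else {})"
    (is "?L = ?R")
proof (intro equalityI subsetI)
  fix u assume u: "u \<in> ?L"
  obtain y i s where [simp]: "u = (y, i, s)" by (cases u)
  have lr: "locally_regular adj (2 ^ n - 4) (y, i, s)" using u by simp
  note f = locally_regular_minus_fourD[OF n lr]
  obtain k where k: "n = Suc (Suc k)" "k \<ge> 2" using n by (cases n; cases "n - 1") auto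
  have "y = top"
  proof (rule ccontr)
    assume neq: "y \<noteq> top"
    have "y < 2 ^ Suc (Suc k)" using f k by simp
    then show False
    proof (cases rule: two_power_cases)
      case low
      obtain a b c where abc: "a < 2 ^ n" "b < 2 ^ n" "c < 2 ^ n"
          "indep y a b" "indep y b c" "indep y a c"
          "eps n y a b * eps n y b c * eps n y a c = 1"
        using exists_positive_triangle[of "Suc k" y] low f(5) k by auto
      have ca: "compat y a b" "compat y b c" "compat y a c" using f(8) abc by auto
      have tri: "in_triangle adj (y, a, t)" "in_triangle adj (y, b, t)" if "t = 1 \<or> t = -1" for t
      proof -
        show "in_triangle adj (y, a, t)" using ca abc(7) that by (intro in_triangleI)
        show "in_triangle adj (y, b, t)"
          using ca abc(7) that compat_sym eps_sym[of n y b a] eps_sym[of n y c a]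
          by (intro in_triangleI[of y b c a]) (auto simp: mult_ac)
      qed
      \<comment> \<open>The index \<open>i\<close> cannot lie in both the span of \<open>y\<close>,
        \<open>a\<close> and the span of \<open>y\<close>, \<open>b\<close>, as these meet only in
        the span of \<open>y\<close>. Two corners of the triangle therefore suffice.\<close>
      have "indep y i a \<or> indep y i b" using abc(4) f by (auto simp: indep_def)
      then obtain x where x: "x = a \<or> x = b" "indep y i x" by auto
      then have "compat y i x" using f abc by auto
      then have "adj (y, i, s) (y, x, s * eps n y i x)" using f by simp
      moreover have "in_triangle adj (y, x, s * eps n y i x)"
        using x tri abc f sign_mult[OF f(4) eps_sign[of n y i x]] by auto
      ultimately show False using u by auto
    next
      case (high z)
      then have "z \<noteq> 0" using neq k by auto
      then obtain a b where ab: "a < 2 ^ Suc k" "b < 2 ^ Suc k" "indep y a b" "rho n y a b = nm n y"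
        using exists_rho_nm[of k z] high k by auto
      then have lt: "a < 2 ^ n" "b < 2 ^ n" using k by auto
      have "compat y a b" using f(8) lt ab by simp
      then have "rho n y a b = g n" using compat_indep lt ab f(1) by simp
      then show False using ab f(7) g_sign[of n] by auto
    qed
  qed
  then show "u \<in> ?R" using f top_bounds[of ] n by auto
next
  fix u assume "u \<in> ?R"
  then obtain i s where g: "g (n - 1) = g n" and u: "u = (top, i, s)"
    and ir: "i < 2 ^ n" "i \<noteq> 0" "i \<noteq> top" "s = 1 \<or> s = -1"
    by (auto split: if_splits)
  have n3: "n \<ge> 3" using n by simp
  note t = top_bounds[OF n3]
  have gn: "g n \<noteq> - g n" using g_sign[of n] by auto
  have ct: "compat top a b \<longleftrightarrow> a < 2 ^ n \<and> b < 2 ^ n \<and> indep top a b" for a b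
    using compat_top[OF n3, of a b] g gn t by (auto simp: indep_def)
  have deg: "card (neighbours adj (top, a, x)) = 2 ^ n - 4"
    if "a < 2 ^ n" "a \<noteq> 0" "a \<noteq> top" "x = 1 \<or> x = -1" for a x
  proof -
    have "{b. compat top a b} = {..<2 ^ n} - {0, top, a, a XOR top}"
      using ct that t by (auto simp: indep_def)
    then show ?thesis unfolding card_neighbours_adj[OF that(4)] using that t by (simp only: card_minus_four not_False_eq_True)
  qed
  have nb: "\<exists>a x. v = (top, a, x) \<and> a < 2 ^ n \<and> a \<noteq> 0 \<and> a \<noteq> top \<and> (x = 1 \<or> x = -1)"
    if "adj u v" for v
  proof (cases v)
    case (fields y a x)
    then have c: "y = top" "compat top i a" "x = s * eps n top i a" using that u by auto
    then have "x = 1 \<or> x = -1" using ir t ct by (simp add: sign_mult eps_sign)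
    then show ?thesis using c fields ct by (auto simp: indep_def)
  qed
  have sq: "top_sign a * top_sign a = 1" for a
    by (simp add: top_sign_def)
  have free: "\<not> in_triangle adj (top, a, x)" for a x
  proof
    assume "in_triangle adj (top, a, x)"
    then obtain b c where c: "compat top a b" "compat top b c" "compat top c a"
      and x: "x = 1 \<or> x = -1" "x = x * eps n top a b * eps n top b c * eps n top c a"
      by (auto simp: in_triangle_def)
    have "eps n top a b * eps n top b c * eps n top c a =
        - (top_sign a * top_sign a) * (top_sign b * top_sign b) * (top_sign c * top_sign c)"
      using c by (simp add: ct eps_top_indep[OF n3] mult_ac)
    then show False using x by (auto simp: sq)
  qed
  have "locally_regular adj (2 ^ n - 4) u"
    unfolding locally_regular_def using deg[OF ir] deg nb u by blast
  then show "u \<in> ?L" using nb free by blast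
qed

end

section \<open>Isomorphisms of the block structure\<close>

text \<open>The relations live on whole types, and \<open>E_V\<close> and \<open>F_W\<close> make
  everything outside the vertex sets isolated. Hence \<open>neighbours\<close> does not have to
  mention the vertex sets.\<close>

locale graph_bijection =
  fixes f :: "'a \<Rightarrow> 'b" and V :: "'a set" and E :: "'a \<Rightarrow> 'a \<Rightarrow> bool"
    and W :: "'b set" and F :: "'b \<Rightarrow> 'b \<Rightarrow> bool"
  assumes bij: "bij_betw f V W"
    and edge: "u \<in> V \<Longrightarrow> v \<in> V \<Longrightarrow> E u v \<longleftrightarrow> F (f u) (f v)"
    and E_V: "E u v \<Longrightarrow> u \<in> V \<and> v \<in> V"
    and F_W: "F w x \<Longrightarrow> w \<in> W \<and> x \<in> W"
begin

lemma image_neighbours: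
  assumes "u \<in> V"
  shows "neighbours F (f u) = f ` neighbours E u"
proof (intro equalityI subsetI)
  fix w assume "w \<in> neighbours F (f u)"
  then have w: "F (f u) w" by (simp add: neighbours_def)
  then have "w \<in> f ` V" using F_W bij unfolding bij_betw_def by blast
  then obtain v where "v \<in> V" "w = f v" by blast
  then show "w \<in> f ` neighbours E u" using w edge assms unfolding neighbours_def by blast
next
  fix w assume "w \<in> f ` neighbours E u"
  then show "w \<in> neighbours F (f u)" using edge E_V unfolding neighbours_def by blast
qed

lemma card_neighbours:
  assumes "u \<in> V"
  shows "card (neighbours F (f u)) = card (neighbours E u)"
proof -
  have "neighbours E u \<subseteq> V" using E_V unfolding neighbours_def by blast
  then have "inj_on f (neighbours E u)"
    using bij by (meson bij_betw_imp_inj_on inj_on_subset)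
  then show ?thesis by (simp add: image_neighbours assms card_image)
qed

lemma all_neighbours:
  assumes "u \<in> V"
  shows "(\<forall>w. F (f u) w \<longrightarrow> Q w) \<longleftrightarrow> (\<forall>v. E u v \<longrightarrow> Q (f v))"
  using image_neighbours[OF assms] by (auto simp: neighbours_def set_eq_iff)

lemma locally_regular_iff:
  assumes "u \<in> V"
  shows "locally_regular F d (f u) \<longleftrightarrow> locally_regular E d u"
proof -
  have "card (neighbours F (f v)) = card (neighbours E v)" if "E u v" for v
    using that E_V card_neighbours by blast
  then show ?thesis
    unfolding locally_regular_def all_neighbours[OF assms] card_neighbours[OF assms] by auto
qed

lemma in_triangle_iff:
  assumes "u \<in> V"
  shows "in_triangle F (f u) \<longleftrightarrow> in_triangle E u"
proof -
  have "in_triangle F (f u) \<longleftrightarrow> \<not> (\<forall>w. F (f u) w \<longrightarrow> (\<forall>x. F w x \<longrightarrow> \<not> F x (f u)))"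
    unfolding in_triangle_def by blast
  also have "\<dots> \<longleftrightarrow> \<not> (\<forall>v. E u v \<longrightarrow> (\<forall>x. E v x \<longrightarrow> \<not> E x u))"
    unfolding all_neighbours[OF assms]
  proof -
    have "(\<forall>x. F (f v) x \<longrightarrow> \<not> F x (f u)) \<longleftrightarrow> (\<forall>x. E v x \<longrightarrow> \<not> E x u)" if "E u v" for v
    proof -
      have "v \<in> V" using that E_V by blast
      then show ?thesis using all_neighbours[of v "\<lambda>x. \<not> F x (f u)"] assms edge E_V by blast
    qed
    then show "(\<not> (\<forall>v. E u v \<longrightarrow> (\<forall>x. F (f v) x \<longrightarrow> \<not> F x (f u)))) \<longleftrightarrow>
        \<not> (\<forall>v. E u v \<longrightarrow> (\<forall>x. E v x \<longrightarrow> \<not> E x u))" by blast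
  qed
  finally show ?thesis unfolding in_triangle_def by blast
qed

lemma image_Collect:
  assumes "\<And>u. u \<in> V \<Longrightarrow> P u \<longleftrightarrow> Q (f u)" "{u. P u} \<subseteq> V" "{w. Q w} \<subseteq> W"
  shows "f ` {u. P u} = {w. Q w}"
proof -
  have "f ` V = W" using bij by (simp add: bij_betw_def)
  then show ?thesis using assms by blast
qed

lemma inverse: "graph_bijection (inv_into V f) W F V E"
proof
  show "bij_betw (inv_into V f) W V" using bij by (rule bij_betw_inv_into)
  show "F w x \<longleftrightarrow> E (inv_into V f w) (inv_into V f x)" if "w \<in> W" "x \<in> W" for w x
  proof -
    have "inv_into V f w \<in> V" "inv_into V f x \<in> V"
      using that bij by (auto simp: bij_betw_def intro!: inv_into_into)
    then show ?thesis
      using that edge[of "inv_into V f w" "inv_into V f x"] bij by (simp add: bij_betw_inv_into_right)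
  qed
qed (use E_V F_W in blast)+

end

text \<open>Collects what is used about the indices of zero divisors. If
  \<open>g (n - 1) = g n\<close>, the hub of the top block has no neighbour, so adjacency cannot
  decide whether it is a vertex; this is settled separately by
  \<open>not_zero_divisor_top\<close>.\<close>

locale cd_vertices = cd_signs +
  fixes V :: "(nat \<times> nat \<times> real) set"
  assumes adj_V: "adj u v \<Longrightarrow> u \<in> V"
    and V_range: "V \<subseteq> {..<2 ^ n} \<times> ({..<2 ^ n} - {0}) \<times> {1, -1}"
    and top_hub_not_V: "n \<ge> 3 \<Longrightarrow> g (n - 1) = g n \<Longrightarrow> (top, top, s) \<notin> V"
begin

text \<open>The index form of the vertex set of \<open>C(e_y)\<close>; see
  \<open>gamma_e_C_eq\<close>.\<close>

definition block :: "nat \<Rightarrow> (nat \<times> nat \<times> real) set" where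
  "block y = {u \<in> V. fst u = y}"

lemma card_neighbours_V:
  assumes "card (neighbours adj u) > 0"
  shows "u \<in> V"
proof -
  obtain v where "adj u v"
    using assms by (metis card_gt_0_iff neighbours_def ex_in_conv mem_Collect_eq)
  then show ?thesis by (rule adj_V)
qed

text \<open>Every index \<open>a\<close> other than \<open>i\<close> is compatible with
  \<open>i\<close>, and \<open>i\<close> with some \<open>b\<close>; so each triple over
  \<open>y\<close> has a neighbour and is a vertex.\<close>

lemma block_full:
  assumes "n \<ge> 3" "card (neighbours adj (y, i, s)) = 2 ^ n - 2"
  shows "block y = {y} \<times> ({..<2 ^ n} - {0}) \<times> {1, -1}"
proof -
  have pos: "(2::nat) ^ n - 2 > 0" using power_bounds(1)[OF assms(1)] by simp
  then have r: "y < 2 ^ n" "i < 2 ^ n" "i \<noteq> 0" "s = 1 \<or> s = -1"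
    using card_neighbours_pos[of y i s] assms(2) by auto
  then have c: "{j. compat y i j} = {..<2 ^ n} - {0, i}"
    using assms by (intro compat_of_full_degree) (simp_all add: card_neighbours_adj)
  obtain b where b: "b < 2 ^ n" "b \<noteq> 0" "b \<noteq> i" using exists_outside[of n i] assms by auto
  have "(y, a, t) \<in> V" if "a < 2 ^ n" "a \<noteq> 0" "t = 1 \<or> t = -1" for a t
  proof (cases "a = i")
    case True
    then have "adj (y, a, t) (y, b, t * eps n y a b)" using b c that by auto
    then show ?thesis by (rule adj_V)
  next
    case False
    then have "compat y a i" using c that compat_sym by blast
    then have "adj (y, a, t) (y, i, t * eps n y a i)" using that by auto
    then show ?thesis by (rule adj_V)
  qed
  then show ?thesis using V_range by (auto simp: block_def)
qed

lemma locally_regular_block: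
  assumes "n \<ge> 3" "g n = 1"
  shows "{u. locally_regular adj (2 ^ n - 2) u} = block 0"
proof -
  have pos: "(2::nat) ^ n - 2 > 0" using power_bounds(1)[OF assms(1)] by simp
  have "{u. locally_regular adj (2 ^ n - 2) u} \<subseteq> V"
    using pos card_neighbours_V by (auto simp: locally_regular_def)
  then show ?thesis
    using V_range assms(2) unfolding locally_regular_full[OF assms(1)] by (auto simp: block_def)
qed

lemma triangle_free_block:
  assumes "n \<ge> 4" "g (n - 1) = g n"
  shows "{u. locally_regular adj (2 ^ n - 4) u \<and> (\<forall>v. adj u v \<longrightarrow> \<not> in_triangle adj v)} = block top"
proof -
  have pos: "(2::nat) ^ n - 4 > 0" using power_bounds(2)[OF assms(1)] by simp
  have "{u. locally_regular adj (2 ^ n - 4) u \<and> (\<forall>v. adj u v \<longrightarrow> \<not> in_triangle adj v)} \<subseteq> V"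
    using pos card_neighbours_V by (auto simp: locally_regular_def)
  moreover have "(top, top, s) \<notin> V" for s using top_hub_not_V assms by simp
  ultimately show ?thesis
    using V_range assms(2) unfolding locally_regular_triangle_free[OF assms(1)]
    by (auto simp: block_def)
qed

lemma hub_degree:
  assumes "n \<ge> 3" "g (n - 1) = - g n"
  shows "card (neighbours adj (top, top, 1)) = 2 ^ n - 2"
  using assms top_bounds card_compat_hub[of top] by (simp add: card_neighbours_adj)

lemma block_top_full:
  assumes "n \<ge> 3" "g (n - 1) = - g n"
  shows "block top = {top} \<times> ({..<2 ^ n} - {0}) \<times> {1, -1}"
  using block_full[OF assms(1) hub_degree[OF assms]] .

lemma adj_block: "adj u v \<Longrightarrow> fst u = fst v"
  by (cases u; cases v) auto

lemma adj_V': "adj u v \<Longrightarrow> u \<in> V \<and> v \<in> V"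
  using adj_V adj_sym by blast

text \<open>Connectedness, in the form that a function constant along edges is constant. Every
  triple lies over the hub or is adjacent to one of the two triples over the hub, and these two are
  joined through a triangle of indices whose \<open>eps\<close> multiply to
  \<open>-1\<close>.\<close>

lemma block_top_connected:
  assumes n: "n \<ge> 3" and g: "g (n - 1) = - g n"
    and inv: "\<And>u v. adj u v \<Longrightarrow> p u = p v"
    and u: "u \<in> block top"
  shows "p u = p (top, top, 1)"
proof -
  note t = top_bounds[OF n]
  have hub: "p (top, i, s) = p (top, top, s * eps n top i top)"
    if "i < 2 ^ n" "i \<noteq> 0" "i \<noteq> top" "s = 1 \<or> s = -1" for i s
    using that t g compat_hub_right[of top i] by (intro inv) auto
  have top4: "top \<ge> 4" using n power_increasing[of 2 "n - 1" "2::nat"] by simp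
  \<comment> \<open>The triangle is \<open>1\<close>, \<open>1 XOR top\<close>, \<open>top\<close>:
    its \<open>eps\<close> are in turn \<open>- g (n - 1)\<close>, \<open>1\<close> and
    \<open>g (n - 1)\<close>, so walking round it changes the sign.\<close>
  define j where "j = 1 XOR top"
  have j: "j = top + 1" unfolding j_def using top4 by (simp add: xor_top)
  have "top + top = 2 ^ n" using n by (cases n) auto
  then have jr: "(1::nat) < 2 ^ n" "j < 2 ^ n" "j \<noteq> 0" "j \<noteq> top" "\<not> j < top" "1 < top" using j top4 by auto
  have g1: "g (n - 1) = 1 \<or> g (n - 1) = -1" using g_sign by simp
  have e1: "eps n top 1 top = g (n - 1)" "eps n top j top = 1"
    using eps_top_hub[OF n, of 1] eps_top_hub[OF n, of j] jr top4 by auto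
  have "eps n top 1 j = - g (n - 1)" using eps_pair[of top 1] t jr top4 unfolding j_def by auto
  moreover have "compat top 1 j" using compat_pair[of top 1] t g jr top4 unfolding j_def by auto
  ultimately have "p (top, 1, g (n - 1)) = p (top, j, -1)"
    using g1 by (intro inv) auto
  moreover have "p (top, 1, g (n - 1)) = p (top, top, 1)"
    using hub[of 1 "g (n - 1)"] g1 jr e1 by auto
  moreover have "p (top, j, -1) = p (top, top, -1)"
    using hub[of j "-1"] jr e1 by auto
  ultimately have pm: "p (top, top, -1) = p (top, top, 1)" by simp
  obtain i s where u': "u = (top, i, s)" "i < 2 ^ n" "i \<noteq> 0" "s = 1 \<or> s = -1"
    using u unfolding block_top_full[OF n g] by auto
  show ?thesis
  proof (cases "i = top")
    case True
    then show ?thesis using u' pm by auto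
  next
    case False
    have "s * eps n top i top = 1 \<or> s * eps n top i top = -1"
      using u' t by (intro sign_mult eps_sign) auto
    then show ?thesis using hub[of i s] u' False pm by auto
  qed
qed

end

text \<open>Only dependent pairs are compatible here, and on these \<open>eps\<close> is determined
  by the hub values and by \<open>nm\<close> of the top index, thus by
  \<open>g (n - 1)\<close>.\<close>

lemma adj_top_cong:
  assumes "cd_signs g n" "cd_signs h n" "n \<ge> 3" "g (n - 1) = h (n - 1)" "g n = h n" "g (n - 1) = - g n"
  shows "cd_signs.adj g n (2 ^ (n - 1), i, s) v \<longleftrightarrow> cd_signs.adj h n (2 ^ (n - 1), i, s) v"
proof -
  interpret G: cd_signs g n by fact
  interpret H: cd_signs h n by fact
  let ?t = "2 ^ (n - 1) :: nat"
  note t = G.top_bounds[OF assms(3)] H.top_bounds[OF assms(3)]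
  have c: "G.compat ?t i j \<longleftrightarrow> H.compat ?t i j" for j
    unfolding G.compat_top[OF assms(3)] H.compat_top[OF assms(3)] using assms by simp
  have "G.eps n ?t i j = H.eps n ?t i j" if cj: "G.compat ?t i j" for j
  proof -
    have gn: "g n \<noteq> - g n" using G.g_sign[of n] by auto
    have r: "i \<noteq> 0" "j \<noteq> 0" "i \<noteq> j" "i < 2 ^ n" "j < 2 ^ n" "i = ?t \<or> j = ?t \<or> j = i XOR ?t"
      using cj gn assms(6) unfolding G.compat_top[OF assms(3)] by (auto split: if_splits)
    then consider "i = ?t" | "i \<noteq> ?t" "j = ?t" | "i \<noteq> ?t" "j = i XOR ?t" by auto
    then show ?thesis
    proof cases
      case 1
      then show ?thesis
        using r G.eps_top_hub[OF assms(3), of j] H.eps_top_hub[OF assms(3), of j] assms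
        by (simp add: G.eps_sym[of n ?t ?t] H.eps_sym[of n ?t ?t])
    next
      case 2
      then show ?thesis
        using r G.eps_top_hub[OF assms(3), of i] H.eps_top_hub[OF assms(3), of i] assms by simp
    next
      case 3
      then show ?thesis
        using r G.eps_pair[of ?t i] H.eps_pair[of ?t i] t assms by simp
    qed
  qed
  then show ?thesis using c by (cases v) auto
qed

text \<open>The set computed in \<open>locally_regular_full\<close> is nonempty iff the last sign is
  \<open>1\<close>, and the bijection maps it onto its counterpart.\<close>

lemma last_sign_determined:
  assumes "cd_vertices g n V" "cd_vertices h n W" "n \<ge> 3"
    and "graph_bijection f V (cd_signs.adj g n) W (cd_signs.adj h n)"
  shows "g n = h n" "g n = 1 \<Longrightarrow> f ` cd_vertices.block V 0 = cd_vertices.block W 0"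
proof -
  interpret G: cd_vertices g n V by fact
  interpret H: cd_vertices h n W by fact
  interpret f: graph_bijection f V G.adj W H.adj by fact
  have pos: "(2::nat) ^ n - 2 > 0" using G.power_bounds(1)[OF assms(3)] by simp
  have im: "f ` {u. locally_regular G.adj (2 ^ n - 2) u} = {w. locally_regular H.adj (2 ^ n - 2) w}"
  proof (rule f.image_Collect)
    show "{u. locally_regular G.adj (2 ^ n - 2) u} \<subseteq> V"
      using pos G.card_neighbours_V by (auto simp: locally_regular_def)
    show "{u. locally_regular H.adj (2 ^ n - 2) u} \<subseteq> W"
      using pos H.card_neighbours_V by (auto simp: locally_regular_def)
  qed (simp add: f.locally_regular_iff)
  have "(0, 1, 1) \<in> {0::nat} \<times> ({..<2 ^ n} - {0::nat}) \<times> {1, -1::real}" using assms(3) by auto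
  then have ne: "{0::nat} \<times> ({..<2 ^ n} - {0::nat}) \<times> {1, -1::real} \<noteq> {}" by blast
  have "g n = 1 \<longleftrightarrow> h n = 1"
    using im ne unfolding G.locally_regular_full[OF assms(3)] H.locally_regular_full[OF assms(3)]
    by (metis image_is_empty)
  then show gh: "g n = h n" using G.g_sign[of n] H.g_sign[of n] by auto
  show "f ` G.block 0 = H.block 0" if "g n = 1"
    using im that gh G.locally_regular_block[OF assms(3)] H.locally_regular_block[OF assms(3)] by simp
qed

text \<open>The set computed in \<open>locally_regular_triangle_free\<close> is nonempty for
  \<open>g\<close>, hence also for \<open>h\<close>.\<close>

lemma triangle_free_image:
  assumes "cd_vertices g n V" "cd_vertices h n W" "n \<ge> 4"
    and "graph_bijection f V (cd_signs.adj g n) W (cd_signs.adj h n)" "g (n - 1) = g n"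
  shows "h (n - 1) = h n" "f ` cd_vertices.block V (2 ^ (n - 1)) = cd_vertices.block W (2 ^ (n - 1))"
proof -
  interpret G: cd_vertices g n V by fact
  interpret H: cd_vertices h n W by fact
  interpret f: graph_bijection f V G.adj W H.adj by fact
  have pos: "(2::nat) ^ n - 4 > 0" using G.power_bounds(2)[OF assms(3)] by simp
  let ?P = "\<lambda>u. locally_regular G.adj (2 ^ n - 4) u \<and> (\<forall>v. G.adj u v \<longrightarrow> \<not> in_triangle G.adj v)"
  let ?Q = "\<lambda>u. locally_regular H.adj (2 ^ n - 4) u \<and> (\<forall>v. H.adj u v \<longrightarrow> \<not> in_triangle H.adj v)"
  have im: "f ` {u. ?P u} = {w. ?Q w}"
  proof (rule f.image_Collect)
    show "{u. ?P u} \<subseteq> V"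
      using pos G.card_neighbours_V unfolding locally_regular_def by fastforce
    show "{u. ?Q u} \<subseteq> W"
      using pos H.card_neighbours_V unfolding locally_regular_def by fastforce
    show "?P u \<longleftrightarrow> ?Q (f u)" if "u \<in> V" for u
    proof -
      have "in_triangle H.adj (f v) \<longleftrightarrow> in_triangle G.adj v" if "G.adj u v" for v
        using that f.E_V f.in_triangle_iff by blast
      then show ?thesis
        unfolding f.all_neighbours[OF that] f.locally_regular_iff[OF that] by blast
    qed
  qed
  have "(1::nat) < 2 ^ (n - 1)" "(1::nat) < 2 ^ n" using assms(3) by (auto intro!: one_less_power)
  then have "(2 ^ (n - 1), 1, 1) \<in> {2 ^ (n - 1)::nat} \<times> ({..<2 ^ n} - {0::nat, 2 ^ (n - 1)}) \<times> {1, -1::real}"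
    by auto
  then have ne: "{u. ?P u} \<noteq> {}"
    using assms(5) unfolding G.locally_regular_triangle_free[OF assms(3)] by auto
  show h: "h (n - 1) = h n"
  proof (rule ccontr)
    assume "h (n - 1) \<noteq> h n"
    then have "{w. ?Q w} = {}" unfolding H.locally_regular_triangle_free[OF assms(3)] by simp
    then show False using im ne by blast
  qed
  show "f ` G.block (2 ^ (n - 1)) = H.block (2 ^ (n - 1))"
    using im assms(5) h G.triangle_free_block[OF assms(3)] H.triangle_free_block[OF assms(3)] by simp
qed

text \<open>By connectedness the image lies in one block. That block contains the image of the hub,
  a vertex of degree \<open>2 ^ n - 2\<close>, so it is full; equal cardinalities then give
  equality.\<close>

lemma hub_block_image:
  assumes "cd_vertices g n V" "cd_vertices h n W" "n \<ge> 3"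
    and "graph_bijection f V (cd_signs.adj g n) W (cd_signs.adj h n)" "g (n - 1) = - g n"
  obtains y where "f ` cd_vertices.block V (2 ^ (n - 1)) = cd_vertices.block W y"
proof -
  interpret G: cd_vertices g n V by fact
  interpret H: cd_vertices h n W by fact
  interpret f: graph_bijection f V G.adj W H.adj by fact
  let ?t = "2 ^ (n - 1) :: nat"
  have Bt: "G.block ?t = {?t} \<times> ({..<2 ^ n} - {0}) \<times> {1, -1}"
    using G.block_top_full assms by simp
  then have hub: "(?t, ?t, 1) \<in> G.block ?t" using G.top_bounds[OF assms(3)] by auto
  obtain y i s where w: "f (?t, ?t, 1) = (y, i, s)" by (cases "f (?t, ?t, 1)")
  have "card (neighbours H.adj (y, i, s)) = 2 ^ n - 2"
    using f.card_neighbours[of "(?t, ?t, 1)"] G.hub_degree[OF assms(3,5)] hub w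
    by (simp add: G.block_def)
  then have By: "H.block y = {y} \<times> ({..<2 ^ n} - {0}) \<times> {1, -1}"
    using H.block_full assms(3) by blast
  have same: "fst (f u) = fst (f v)" if "G.adj u v" for u v
    using that G.adj_V' f.edge H.adj_block by blast
  have sub: "f ` G.block ?t \<subseteq> H.block y"
  proof
    fix x assume "x \<in> f ` G.block ?t"
    then obtain u where u: "u \<in> G.block ?t" "x = f u" by auto
    have "fst (f u) = fst (f (?t, ?t, 1))"
      using G.block_top_connected[OF assms(3,5), of "\<lambda>u. fst (f u)" u] same u by simp
    moreover have "f u \<in> W" using u f.bij by (auto simp: G.block_def bij_betw_def)
    ultimately show "x \<in> H.block y" using u w by (simp add: H.block_def)
  qed
  have "inj_on f (G.block ?t)"
    using f.bij by (auto simp: G.block_def bij_betw_def intro: inj_on_subset)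
  then have "card (f ` G.block ?t) = card (H.block y)"
    unfolding Bt By by (simp add: card_image card_cartesian_product)
  moreover have "finite (H.block y)" unfolding By by simp
  ultimately have "f ` G.block ?t = H.block y" using sub by (intro card_subset_eq)
  then show thesis by (rule that)
qed

text \<open>The set \<open>A\<close> is a union of components on which both graphs agree. The
  corrected map is \<open>f\<close> followed by the exchange of \<open>A\<close> with its image
  under \<open>f\<close>.\<close>

lemma graph_bijection_swap:
  fixes f :: "'a \<Rightarrow> 'a"
  assumes "graph_bijection f V E W F" and A: "A \<subseteq> V" "A \<subseteq> W" "f ` A \<inter> A = {}"
    and EF: "\<And>u v. u \<in> A \<Longrightarrow> E u v \<longleftrightarrow> F u v"
    and E_A: "\<And>u v. E u v \<Longrightarrow> u \<in> A \<longleftrightarrow> v \<in> A" and F_A: "\<And>u v. F u v \<Longrightarrow> u \<in> A \<longleftrightarrow> v \<in> A"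
  obtains f' where "graph_bijection f' V E W F" "f' ` A = A"
proof -
  interpret f: graph_bijection f V E W F by fact
  \<comment> \<open>An element of \<open>A\<close> goes to its image and back, an element sent into
    \<open>A\<close> is carried on into the image of \<open>A\<close>, and the rest is left as under
    \<open>f\<close>.\<close>
  define f' where "f' u = (if u \<in> A then u else if f u \<in> A then f (f u) else f u)" for u
  have inj: "f u = f v \<longleftrightarrow> u = v" if "u \<in> V" "v \<in> V" for u v
    using that f.bij by (auto simp: bij_betw_def inj_on_def)
  have fV: "f ` V = W" using f.bij by (simp add: bij_betw_def)
  have f'A: "f' u \<in> A \<longleftrightarrow> u \<in> A" if "u \<in> V" for u
    using A(3) by (auto simp: f'_def)
  have ffA: "f u \<notin> A" if "u \<in> A" for u using that A(3) by blast
  have nfA: "f u \<in> f ` A \<longleftrightarrow> u \<in> A" if "u \<in> V" for u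
    using that inj A(1) by blast
  have inj': "inj_on f' V"
  proof (rule inj_onI)
    fix u v assume uv: "u \<in> V" "v \<in> V" "f' u = f' v"
    have w: "w \<in> V" if "w \<in> A" for w using that A by blast
    show "u = v"
      using uv f'A[of u] f'A[of v] inj[of u v] inj[of "f u" v] inj[of u "f v"] inj[of "f u" "f v"]
        w[of "f u"] w[of "f v"]
      unfolding f'_def by (auto split: if_splits)
  qed
  have "f' ` V = W"
  proof (intro equalityI subsetI)
    fix w assume "w \<in> f' ` V"
    then obtain u where u: "u \<in> V" "w = f' u" by blast
    then have "f u \<in> W" "f u \<in> A \<Longrightarrow> f (f u) \<in> W" using fV A by blast+
    then show "w \<in> W" using u A by (auto simp: f'_def)
  next
    fix w assume w: "w \<in> W"
    show "w \<in> f' ` V"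
    proof (cases "w \<in> A")
      case True
      then show ?thesis using A by (intro image_eqI[of _ _ w]) (auto simp: f'_def)
    next
      case wA: False
      obtain u where u: "u \<in> V" "w = f u" using w fV by blast
      show ?thesis
      proof (cases "u \<in> A")
        case True
        then obtain v where v: "v \<in> V" "u = f v" using A fV by blast
        then have "v \<notin> A" using True A(3) by blast
        then show ?thesis using u v True by (intro image_eqI[of _ _ v]) (auto simp: f'_def)
      next
        case False
        then show ?thesis using u wA by (intro image_eqI[of _ _ u]) (auto simp: f'_def)
      qed
    qed
  qed
  then have bij': "bij_betw f' V W" using inj' by (simp add: bij_betw_def)
  have edge': "E u v \<longleftrightarrow> F (f' u) (f' v)" if uv: "u \<in> V" "v \<in> V" for u v
  proof -
    have edge: "E u v \<longleftrightarrow> F (f u) (f v)" by (rule f.edge[OF uv])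
    consider (both) "u \<in> A" "v \<in> A" | (one) "(u \<in> A) \<noteq> (v \<in> A)"
      | (pre) "u \<notin> A" "v \<notin> A" "f u \<in> A" "f v \<in> A"
      | (mixed) "u \<notin> A" "v \<notin> A" "(f u \<in> A) \<noteq> (f v \<in> A)"
      | (rest) "u \<notin> A" "v \<notin> A" "f u \<notin> A" "f v \<notin> A" by blast
    then show ?thesis
    proof cases
      case both
      then show ?thesis using EF by (simp add: f'_def)
    next
      case one
      then have "\<not> E u v" "\<not> F (f' u) (f' v)" using E_A F_A f'A uv by blast+
      then show ?thesis by simp
    next
      case pre
      then have "F (f (f u)) (f (f v)) \<longleftrightarrow> E (f u) (f v)" using f.edge A(1) by blast
      then show ?thesis using pre edge EF by (simp add: f'_def)
    next
      case mixed
      then have "\<not> E u v" using edge F_A by blast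
      \<comment> \<open>If, say, \<open>f u\<close> lies in \<open>A\<close>, such an edge reads
        \<open>F (f (f u)) (f v)\<close> and pulls back to an edge from \<open>f u\<close> in
        \<open>A\<close> to \<open>v\<close> outside.\<close>
      moreover have "\<not> F (f' u) (f' v)"
      proof
        assume F: "F (f' u) (f' v)"
        have "F (f x) (f y) \<Longrightarrow> x \<in> A \<longleftrightarrow> y \<in> A" if "x \<in> V" "y \<in> V" for x y
          using that f.edge E_A by blast
        then show False
          using F mixed uv A(1) by (auto simp: f'_def split: if_splits)
      qed
      ultimately show ?thesis by simp
    next
      case rest
      then show ?thesis using edge by (simp add: f'_def)
    qed
  qed
  have "graph_bijection f' V E W F"
    using bij' edge' f.E_V f.F_W by unfold_locales blast+
  moreover have "f' ` A = A" by (auto simp: f'_def)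
  ultimately show thesis by (rule that)
qed

text \<open>Whether the last two signs agree is an invariant, by \<open>triangle_free_image\<close>
  for \<open>f\<close> and for its inverse. If they differ, the top blocks of both graphs coincide
  as sets of triples with adjacency, and exchanging blocks repairs an \<open>f\<close> that sends
  this block elsewhere.\<close>

lemma top_sign_determined:
  assumes "cd_vertices g n V" "cd_vertices h n W" and n: "n \<ge> 4"
    and f: "graph_bijection f V (cd_signs.adj g n) W (cd_signs.adj h n)"
  shows "g (n - 1) = h (n - 1)"
    and "\<exists>f'. graph_bijection f' V (cd_signs.adj g n) W (cd_signs.adj h n) \<and>
      f' ` cd_vertices.block V (2 ^ (n - 1)) = cd_vertices.block W (2 ^ (n - 1))"
proof -
  interpret G: cd_vertices g n V by fact
  interpret H: cd_vertices h n W by fact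
  interpret f: graph_bijection f V G.adj W H.adj by fact
  let ?t = "2 ^ (n - 1) :: nat"
  have n3: "n \<ge> 3" using n by simp
  have gh: "g n = h n" using last_sign_determined(1)[OF assms(1,2) n3 f] .
  have "g (n - 1) = g n \<longleftrightarrow> h (n - 1) = h n"
    using triangle_free_image(1)[OF assms(1,2) n f] triangle_free_image(1)[OF assms(2,1) n f.inverse]
    by blast
  then show gh': "g (n - 1) = h (n - 1)"
    using gh G.g_sign[of n] G.g_sign[of "n - 1"] H.g_sign[of "n - 1"] by auto
  show "\<exists>f'. graph_bijection f' V G.adj W H.adj \<and> f' ` G.block ?t = H.block ?t"
  proof (cases "g (n - 1) = g n")
    case True
    then show ?thesis using triangle_free_image(2)[OF assms(1,2) n f] f by blast
  next
    case False
    then have neg: "g (n - 1) = - g n" "h (n - 1) = - h n"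
      using gh gh' G.g_sign[of n] G.g_sign[of "n - 1"] by auto
    obtain y where y: "f ` G.block ?t = H.block y"
      using hub_block_image[OF assms(1,2) n3 f neg(1)] by blast
    have same: "G.block ?t = H.block ?t"
      using G.block_top_full[OF n3 neg(1)] H.block_top_full[OF n3 neg(2)] by simp
    show ?thesis
    proof (cases "y = ?t")
      case True
      then show ?thesis using y f by blast
    next
      case False
      have EF: "G.adj u v \<longleftrightarrow> H.adj u v" if "u \<in> G.block ?t" for u v
      proof (cases u)
        case (fields a i s)
        then have "u = (?t, i, s)" using that by (simp add: G.block_def)
        then show ?thesis
          using adj_top_cong[OF G.cd_signs_axioms H.cd_signs_axioms n3 gh' gh neg(1)] by simp
      qed
      have E_A: "u \<in> G.block ?t \<longleftrightarrow> v \<in> G.block ?t" if "G.adj u v" for u v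
        using G.adj_block[OF that] G.adj_V'[OF that] by (simp add: G.block_def)
      have F_A: "u \<in> G.block ?t \<longleftrightarrow> v \<in> G.block ?t" if "H.adj u v" for u v
        using H.adj_block[OF that] H.adj_V'[OF that] by (simp add: same H.block_def)
      have "f ` G.block ?t \<inter> G.block ?t = {}"
      proof -
        have "H.block y \<inter> H.block ?t = {}" using False by (auto simp: H.block_def)
        then show ?thesis using y same by simp
      qed
      moreover have "G.block ?t \<subseteq> V" by (auto simp: G.block_def)
      moreover have "G.block ?t \<subseteq> W" unfolding same by (auto simp: H.block_def)
      ultimately obtain f' where "graph_bijection f' V G.adj W H.adj" "f' ` G.block ?t = G.block ?t"
        using graph_bijection_swap[OF f _ _ _ EF E_A F_A] by metis
      then show ?thesis using same by auto
    qed
  qed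
qed

section \<open>Zero divisors with basis components\<close>

lemma cd_zero_carrier [simp]: "cd_zero k \<in> cd_carrier k"
  by (induction k) auto

lemma cd_basis_carrier [simp]: "cd_basis k j \<in> cd_carrier k"
  by (induction k arbitrary: j) auto

lemma cd_scale_carrier [simp]: "x \<in> cd_carrier k \<Longrightarrow> cd_scale r x \<in> cd_carrier k"
  by (induction k arbitrary: x) auto

lemma cd_conj_carrier [simp]: "x \<in> cd_carrier k \<Longrightarrow> cd_conj x \<in> cd_carrier k"
  by (induction k arbitrary: x) auto

lemma cd_add_carrier [simp]: "x \<in> cd_carrier k \<Longrightarrow> y \<in> cd_carrier k \<Longrightarrow> cd_add x y \<in> cd_carrier k"
  by (induction k arbitrary: x y) force+

lemma cd_mult_carrier [simp]:
  "x \<in> cd_carrier k \<Longrightarrow> y \<in> cd_carrier k \<Longrightarrow> cd_mult g k x y \<in> cd_carrier k"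
  by (induction k arbitrary: x y) auto

lemma cd_scale_zero [simp]: "cd_scale r (cd_zero k) = cd_zero k"
  by (induction k) auto

lemma cd_scale_scale [simp]: "cd_scale r (cd_scale s x) = cd_scale (r * s) x"
  by (induction x) auto

lemma cd_scale_1 [simp]: "cd_scale 1 x = x"
  by (induction x) auto

lemma cd_conj_zero [simp]: "cd_conj (cd_zero k) = cd_zero k"
  by (induction k) auto

lemma cd_conj_scale [simp]: "cd_conj (cd_scale r x) = cd_scale r (cd_conj x)"
  by (induction x) auto

lemma cd_conj_conj [simp]: "cd_conj (cd_conj x) = x"
  by (induction x) auto

lemma cd_add_zero [simp]:
  "x \<in> cd_carrier k \<Longrightarrow> cd_add (cd_zero k) x = x"
  "x \<in> cd_carrier k \<Longrightarrow> cd_add x (cd_zero k) = x"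
  by (induction k arbitrary: x) auto

lemma cd_scale_add:
  "x \<in> cd_carrier k \<Longrightarrow> y \<in> cd_carrier k \<Longrightarrow>
    cd_scale r (cd_add x y) = cd_add (cd_scale r x) (cd_scale r y)"
  by (induction k arbitrary: x y) (auto simp: algebra_simps)

lemma cd_add_eq_zero_iff:
  "x \<in> cd_carrier k \<Longrightarrow> y \<in> cd_carrier k \<Longrightarrow> cd_add x y = cd_zero k \<longleftrightarrow> y = cd_neg x"
  by (induction k arbitrary: x y) auto

lemma cd_scale_eq_zero_iff:
  "x \<in> cd_carrier k \<Longrightarrow> cd_scale r x = cd_zero k \<longleftrightarrow> r = 0 \<or> x = cd_zero k"
  by (induction k arbitrary: x) auto

lemma cd_scale_eq_iff:
  "x \<in> cd_carrier k \<Longrightarrow> cd_scale r x = cd_scale s x \<longleftrightarrow> r = s \<or> x = cd_zero k"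
  by (induction k arbitrary: x) auto

lemma cd_mult_zero [simp]:
  "x \<in> cd_carrier k \<Longrightarrow> cd_mult g k (cd_zero k) x = cd_zero k"
  "x \<in> cd_carrier k \<Longrightarrow> cd_mult g k x (cd_zero k) = cd_zero k"
  by (induction k arbitrary: x) auto

lemma cd_mult_scale [simp]:
  "x \<in> cd_carrier k \<Longrightarrow> y \<in> cd_carrier k \<Longrightarrow> cd_mult g k (cd_scale r x) y = cd_scale r (cd_mult g k x y)"
  "x \<in> cd_carrier k \<Longrightarrow> y \<in> cd_carrier k \<Longrightarrow> cd_mult g k x (cd_scale r y) = cd_scale r (cd_mult g k x y)"
proof (induction k arbitrary: x y)
  case (Suc k)
  note add = cd_scale_add[where k = k]
  {
    case 1
    then show ?case using Suc by (auto simp: add mult_ac)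
  next
    case 2
    then show ?case using Suc by (auto simp: add mult_ac)
  }
qed auto

lemma cd_conj_basis:
  "j < 2 ^ k \<Longrightarrow> cd_conj (cd_basis k j) = cd_scale (conj_sign j) (cd_basis k j)"
  by (induction k arbitrary: j) (auto simp: conj_sign_def)

lemma cd_mult_unit [simp]:
  "x \<in> cd_carrier k \<Longrightarrow> cd_mult g k (cd_basis k 0) x = x"
  "x \<in> cd_carrier k \<Longrightarrow> cd_mult g k x (cd_basis k 0) = x"
proof (induction k arbitrary: x)
  case (Suc k)
  {
    case 1
    then show ?case using Suc by auto
  next
    case 2
    then show ?case using Suc cd_conj_basis[of 0 k] by auto
  }
qed auto

lemma cd_basis_Suc:
  "i < 2 ^ k \<Longrightarrow> cd_basis (Suc k) i = Pr (cd_basis k i) (cd_zero k)"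
  "cd_basis (Suc k) (2 ^ k + i) = Pr (cd_zero k) (cd_basis k i)"
  by auto

lemma cd_mult_basis:
  assumes "i < 2 ^ k" "j < 2 ^ k"
  shows "cd_mult g k (cd_basis k i) (cd_basis k j) = cd_scale (basis_sign g k i j) (cd_basis k (i XOR j))"
  using assms
proof (induction k arbitrary: i j)
  case (Suc k)
  have z: "cd_add (cd_zero k) (cd_zero k) = cd_zero k" by simp
  from Suc.prems show ?case
    by (cases rule: two_power_cases2)
      (simp_all add: cd_basis_Suc Suc.IH xor_less_two_power xor_high_low xor_low_high xor_high_high
        xor.commute cd_conj_basis z mult_ac del: cd_basis.simps)
qed simp

lemma cd_basis_neq_zero [simp]: "cd_basis k j \<noteq> cd_zero k" "cd_zero k \<noteq> cd_basis k j"
  by (induction k arbitrary: j) auto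

lemma cd_scale_basis_eq_iff:
  assumes "i < 2 ^ k" "j < 2 ^ k"
  shows "cd_scale r (cd_basis k i) = cd_scale s (cd_basis k j) \<longleftrightarrow> r = s \<and> (i = j \<or> r = 0)"
  using assms
proof (induction k arbitrary: i j)
  case (Suc k)
  have sym: "cd_zero k = cd_scale a (cd_basis k b) \<longleftrightarrow> a = 0" for a b
    using cd_scale_eq_zero_iff[of "cd_basis k b" k a] by (metis cd_basis_carrier cd_basis_neq_zero(1))
  from Suc.prems show ?case
    by (cases rule: two_power_cases2)
      (auto simp: cd_basis_Suc Suc.IH sym cd_scale_eq_zero_iff simp del: cd_basis.simps)
qed auto

lemma cd_add_scale_basis_eq_zero_iff:
  assumes "i < 2 ^ k" "j < 2 ^ k"
  shows "cd_add (cd_scale r (cd_basis k i)) (cd_scale s (cd_basis k j)) = cd_zero k \<longleftrightarrow>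
    s = - r \<and> (i = j \<or> r = 0)"
  using cd_scale_basis_eq_iff[OF assms(2,1), of s "- r"] by (auto simp: cd_add_eq_zero_iff)

text \<open>Indexing by the xor \<open>y\<close> of the two basis indices, instead of by the second
  one, makes the block a coordinate of the triple.\<close>

definition cd_element :: "nat \<Rightarrow> nat \<times> nat \<times> real \<Rightarrow> cd" where
  "cd_element n = (\<lambda>(y, i, s). Pr (cd_basis n i) (cd_scale s (cd_basis n (i XOR y))))"

definition index_range :: "nat \<Rightarrow> (nat \<times> nat \<times> real) set" where
  "index_range n = {..<2 ^ n} \<times> ({..<2 ^ n} - {0}) \<times> {1, -1}"

lemma cd_element_carrier [simp]: "cd_element n u \<in> cd_carrier (Suc n)"
  by (simp add: cd_element_def split: prod.split)

text \<open>The first component has coefficient \<open>1\<close>, which forces the scalar between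
  two generators of the same line to be \<open>1\<close>.\<close>

lemma cd_line_element_inj: "inj_on (\<lambda>u. cd_line (cd_element n u)) (index_range n)"
proof (rule inj_onI)
  fix u v assume uv: "u \<in> index_range n" "v \<in> index_range n"
    and eq: "cd_line (cd_element n u) = cd_line (cd_element n v)"
  obtain y i s y' j t where [simp]: "u = (y, i, s)" "v = (y', j, t)" by (cases u; cases v)
  have r: "y < 2 ^ n" "i < 2 ^ n" "y' < 2 ^ n" "j < 2 ^ n" "s \<noteq> 0" "i XOR y < 2 ^ n" "j XOR y' < 2 ^ n"
    using uv by (auto simp: index_range_def xor_less_two_power)
  have "cd_scale 1 (cd_element n u) \<in> cd_line (cd_element n u)"
    unfolding cd_line_def by (rule rangeI)
  then have "cd_element n u \<in> cd_line (cd_element n v)" using eq by simp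
  then obtain c where "cd_element n u = cd_scale c (cd_element n v)"
    by (auto simp: cd_line_def)
  then have 1: "cd_scale 1 (cd_basis n i) = cd_scale c (cd_basis n j)"
    and 2: "cd_scale s (cd_basis n (i XOR y)) = cd_scale (c * t) (cd_basis n (j XOR y'))"
    by (simp_all add: cd_element_def)
  from 1 have "c = 1" "i = j" using r by (simp_all add: cd_scale_basis_eq_iff del: cd_scale_1)
  moreover from this 2 have "s = t" "i XOR y = j XOR y'" using r by (auto simp: cd_scale_basis_eq_iff)
  ultimately show "u = v" by simp
qed

section \<open>Products of elements with basis components\<close>

context cd_signs begin

text \<open>Since \<open>s * t = e\<close>, the two vertex signs enter the equation of the first
  component only through \<open>e\<close>.\<close>

lemma sign_transfer:
  fixes a b c e s t h :: real
  assumes "a = 1 \<or> a = -1" "b = 1 \<or> b = -1" "c = 1 \<or> c = -1" "e = 1 \<or> e = -1"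
    "s = 1 \<or> s = -1" "h = 1 \<or> h = -1" "t = s * e"
  shows "a = - (h * (t * c * (s * b))) \<longleftrightarrow> e = - h * c * a * b"
  using assms by (elim disjE) simp_all

lemma sign_solve:
  fixes p q s t :: real
  assumes "p = 1 \<or> p = -1" "q = 1 \<or> q = -1"
  shows "t * p = s * q \<longleftrightarrow> t = s * (p * q)"
  using assms by (elim disjE) auto

text \<open>Each component of the product is a sum of two signed basis elements. They can cancel
  only if they have the same index, which in both components means \<open>y = y'\<close>; the signs
  then give \<open>compat\<close> and \<open>t = s * eps\<close>.\<close>

lemma cd_mult_element_eq_zero_iff:
  assumes "u \<in> index_range n" "v \<in> index_range n" "u \<noteq> v"
  shows "cd_mult g (Suc n) (cd_element n u) (cd_element n v) = cd_zero (Suc n) \<longleftrightarrow> adj u v"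
proof -
  obtain y i s y' j t where [simp]: "u = (y, i, s)" "v = (y', j, t)" by (cases u; cases v)
  have r: "y < 2 ^ n" "i < 2 ^ n" "y' < 2 ^ n" "j < 2 ^ n" "i XOR y < 2 ^ n" "j XOR y' < 2 ^ n"
    and s: "s = 1 \<or> s = -1" "t = 1 \<or> t = -1" and nz: "i \<noteq> 0" "j \<noteq> 0"
    using assms by (auto simp: index_range_def xor_less_two_power)
  let ?k = "i XOR y" and ?l = "j XOR y'"
  have x: "i XOR j < 2 ^ n" "?l XOR ?k < 2 ^ n" "?l XOR i < 2 ^ n" "?k XOR j < 2 ^ n"
    using r by (simp_all add: xor_less_two_power)
  have xe: "i XOR j = ?l XOR ?k \<longleftrightarrow> y = y'" "?l XOR i = ?k XOR j \<longleftrightarrow> y = y'"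
  proof -
    have "?l XOR ?k = (i XOR j) XOR (y XOR y')" "?l XOR i = (i XOR j) XOR y'" "?k XOR j = (i XOR j) XOR y"
      by (simp_all only: ac_simps)
    then show "i XOR j = ?l XOR ?k \<longleftrightarrow> y = y'" "?l XOR i = ?k XOR j \<longleftrightarrow> y = y'" by auto
  qed
  have "cd_mult g (Suc n) (cd_element n u) (cd_element n v) =
      Pr (cd_add (cd_scale (sg n i j) (cd_basis n (i XOR j)))
            (cd_scale (g n * (t * conj_sign ?l * (s * sg n ?l ?k))) (cd_basis n (?l XOR ?k))))
         (cd_add (cd_scale (t * sg n ?l i) (cd_basis n (?l XOR i)))
            (cd_scale (s * (conj_sign j * sg n ?k j)) (cd_basis n (?k XOR j))))"
    using r by (simp add: cd_element_def cd_mult_basis cd_conj_basis mult_ac)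
  moreover have "sg n i j \<noteq> 0" "t * sg n ?l i \<noteq> 0" using sg_sign[of n i j] sg_sign[of n ?l i] r s by auto
  ultimately have "cd_mult g (Suc n) (cd_element n u) (cd_element n v) = cd_zero (Suc n) \<longleftrightarrow>
      y = y' \<and> sg n i j = - (g n * (t * conj_sign ?l * (s * sg n ?l ?k))) \<and> t * sg n ?l i = s * sg n ?k j"
    using x xe nz by (auto simp: cd_add_scale_basis_eq_zero_iff)
  also have "\<dots> \<longleftrightarrow> adj u v"
  proof (cases "y = y'")
    case True
    have sg: "sg n i j = 1 \<or> sg n i j = -1" "sg n ?l ?k = 1 \<or> sg n ?l ?k = -1"
       "sg n ?l i = 1 \<or> sg n ?l i = -1" "sg n ?k j = 1 \<or> sg n ?k j = -1" "g n = 1 \<or> g n = -1"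
       "conj_sign ?l = 1 \<or> conj_sign ?l = -1"
      using r g_sign[of n] by (simp_all add: sg_sign) (simp add: conj_sign_def)
    have adj: "adj u v \<longleftrightarrow> i \<noteq> j \<and> t = s * eps n y i j \<and>
        eps n y i j = - g n * conj_sign ?l * sg n i j * sg n ?l ?k"
      using True r nz s by (auto simp: compat_def)
    have "t * sg n ?l i = s * sg n ?k j \<longleftrightarrow> t = s * eps n y i j"
      using sign_solve[OF sg(3,4)] True by (simp add: eps_def)
    \<comment> \<open>For \<open>i = j\<close> both factors of \<open>eps\<close> are equal, so
      \<open>t = s\<close> and \<open>u = v\<close>.\<close>
    moreover have "i \<noteq> j" if "t = s * eps n y i j"
    proof
      assume "i = j"
      then have "eps n y i j = 1" using r by (simp add: eps_def)
      then show False using that assms \<open>i = j\<close> True by simp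
    qed
    moreover have "sg n i j = - (g n * (t * conj_sign ?l * (s * sg n ?l ?k))) \<longleftrightarrow>
        eps n y i j = - g n * conj_sign ?l * sg n i j * sg n ?l ?k" if "t = s * eps n y i j"
      by (rule sign_transfer) (use that sg s eps_sign[of n y i j] r in simp_all)
    ultimately show ?thesis using True unfolding adj by blast
  qed auto
  finally show ?thesis .
qed

lemma cd_orthogonal_element_iff:
  assumes "u \<in> index_range n" "v \<in> index_range n" "u \<noteq> v"
  shows "cd_orthogonal g (Suc n) (cd_element n u) (cd_element n v) \<longleftrightarrow> adj u v"
  using assms cd_mult_element_eq_zero_iff[of u v] cd_mult_element_eq_zero_iff[of v u] adj_sym
  unfolding cd_orthogonal_def by blast

text \<open>An annihilating element need not have the form \<open>cd_element n v\<close>, so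
  membership is not defined through \<open>adj\<close>.\<close>

definition zero_divisor_indices :: "(nat \<times> nat \<times> real) set" where
  "zero_divisor_indices = {u \<in> index_range n. cd_zero_divisor g (Suc n) (cd_element n u)}"

lemma adj_index_range: "adj u v \<Longrightarrow> u \<in> index_range n \<and> v \<in> index_range n \<and> u \<noteq> v"
proof (cases u; cases v)
  fix y i s y' j t assume "adj u v" and [simp]: "u = (y, i, s)" "v = (y', j, t)"
  then have "y' = y" "compat y i j" "s = 1 \<or> s = -1" "t = s * eps n y i j" by auto
  then show "u \<in> index_range n \<and> v \<in> index_range n \<and> u \<noteq> v"
    using sign_mult[of s "eps n y i j"] eps_sign[of n y i j] by (auto simp: index_range_def compat_def)
qed

lemma cd_element_neq_zero [simp]: "cd_element n u \<noteq> cd_zero (Suc n)"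
  by (simp add: cd_element_def split: prod.split)

lemma adj_zero_divisor_indices: "adj u v \<Longrightarrow> u \<in> zero_divisor_indices"
proof -
  assume uv: "adj u v"
  note r = adj_index_range[OF uv]
  then have "cd_mult g (Suc n) (cd_element n u) (cd_element n v) = cd_zero (Suc n)"
    using cd_mult_element_eq_zero_iff uv by blast
  then have "cd_zero_divisor g (Suc n) (cd_element n u)"
    unfolding cd_zero_divisor_def using cd_element_carrier cd_element_neq_zero by blast
  then show ?thesis using r by (simp add: zero_divisor_indices_def)
qed

end

text \<open>The unit and the element \<open>(0, 1)\<close> both act on pairs by explicit formulas, so the zero
  divisor equations for \<open>((0, 1), s)\<close> reduce to four linear equations in the coordinates.\<close>

lemma not_zero_divisor_top:
  assumes "g m = g (Suc m)" "g m \<noteq> 0" "s = 1 \<or> s = -1"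
  shows "\<not> cd_zero_divisor g (Suc (Suc m)) (Pr (cd_basis (Suc m) (2 ^ m)) (cd_scale s (cd_basis (Suc m) 0)))"
proof
  let ?u = "Pr (cd_basis (Suc m) (2 ^ m)) (cd_scale s (cd_basis (Suc m) 0))"
  have u: "?u = Pr (Pr (cd_zero m) (cd_basis m 0)) (Pr (cd_scale s (cd_basis m 0)) (cd_zero m))"
    by simp
  have ss: "s * s = 1" "s \<noteq> 0" using assms(3) by auto
  \<comment> \<open>By \<open>s * s = 1\<close> and \<open>g m = g (Suc m)\<close> both left-hand
    sides are \<open>g m\<close>, which is nonzero. These are the coefficients that meet once the
    four equations are reduced to one coordinate each.\<close>
  have neq: "s * (g (Suc m) * s) \<noteq> - g m" "g (Suc m) * s * s \<noteq> - g m" using assms by auto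
  have unit: "cd_conj (cd_basis m 0) = cd_basis m 0" using cd_conj_basis[of 0 m] by simp
  have zero: "x = cd_zero m" if "x \<in> cd_carrier m" "cd_scale a x = cd_scale b x" "a \<noteq> b" for a b x
    using that cd_scale_eq_iff by blast
  assume "cd_zero_divisor g (Suc (Suc m)) ?u"
  then obtain v where v: "v \<in> cd_carrier (Suc (Suc m))" "v \<noteq> cd_zero (Suc (Suc m))"
    and uv: "cd_mult g (Suc (Suc m)) ?u v = cd_zero (Suc (Suc m)) \<or>
      cd_mult g (Suc (Suc m)) v ?u = cd_zero (Suc (Suc m))"
    unfolding cd_zero_divisor_def by blast
  obtain p q r t where c: "p \<in> cd_carrier m" "q \<in> cd_carrier m" "r \<in> cd_carrier m" "t \<in> cd_carrier m"
    and [simp]: "v = Pr (Pr p q) (Pr r t)"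
    using v by auto
  have "p = cd_zero m \<and> q = cd_zero m \<and> r = cd_zero m \<and> t = cd_zero m"
    using uv
  proof
    assume "cd_mult g (Suc (Suc m)) ?u v = cd_zero (Suc (Suc m))"
    then have e: "cd_scale (g (Suc m) * s) (cd_conj r) = cd_scale (- g m) (cd_conj q)"
        "cd_scale (- (g (Suc m) * s)) t = cd_neg (cd_conj p)"
        "cd_scale s (cd_conj p) = cd_scale (- g m) t" "cd_scale (- s) q = cd_neg r"
      using c unfolding u by (simp_all add: unit cd_add_eq_zero_iff)
    have r: "r = cd_scale s q" using arg_cong[OF e(4), of cd_neg] by simp
    have p: "cd_conj p = cd_scale (g (Suc m) * s) t" using arg_cong[OF e(2), of cd_neg] by simp
    have "t = cd_zero m"
      using e(3) unfolding p by (intro zero[of t "s * (g (Suc m) * s)" "- g m"]) (use c neq in simp_all)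
    moreover from this have "p = cd_zero m" using arg_cong[OF p, of cd_conj] by simp
    moreover have "cd_conj q = cd_zero m"
      using e(1) unfolding r
      by (intro zero[of "cd_conj q" "g (Suc m) * s * s" "- g m"]) (use c neq in \<open>simp_all add: mult_ac\<close>)
    then have "q = cd_zero m" by (metis cd_conj_conj cd_conj_zero)
    ultimately show ?thesis using r by simp
  next
    assume "cd_mult g (Suc (Suc m)) v ?u = cd_zero (Suc (Suc m))"
    then have e: "cd_scale (g (Suc m) * s) r = cd_scale (- g m) q"
        "cd_scale (g (Suc m) * s) t = cd_neg p"
        "cd_scale (- g m) t = cd_scale (- s) p" "cd_neg r = cd_scale (- s) q"
      using c unfolding u by (simp_all add: unit cd_add_eq_zero_iff)
    have r: "r = cd_scale s q" using arg_cong[OF e(4), of cd_neg] by simp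
    have p: "p = cd_scale (- (g (Suc m) * s)) t" using arg_cong[OF e(2), of cd_neg] by simp
    have "t = cd_zero m"
      using e(3) unfolding p by (intro zero[of t "- g m" "s * (g (Suc m) * s)"]) (use c neq in simp_all)
    moreover have "q = cd_zero m"
      using e(1) unfolding r
      by (intro zero[of q "g (Suc m) * s * s" "- g m"]) (use c neq in \<open>simp_all add: mult_ac\<close>)
    ultimately show ?thesis using r p by simp
  qed
  then show False using v by simp
qed

abbreviation element_line :: "nat \<Rightarrow> nat \<times> nat \<times> real \<Rightarrow> cd set" where
  "element_line n u \<equiv> cd_line (cd_element n u)"

definition element_parts :: "nat \<Rightarrow> nat \<times> nat \<times> real \<Rightarrow> cd \<times> cd" where
  "element_parts n = (\<lambda>(y, i, s). (cd_basis n i, cd_scale s (cd_basis n (i XOR y))))"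

lemma cd_element_parts: "cd_element n u = Pr (fst (element_parts n u)) (snd (element_parts n u))"
  by (simp add: cd_element_def element_parts_def split: prod.split)

section \<open>The graph expressed through index triples\<close>

context cd_signs begin

lemma cd_vertices_zero_divisor_indices: "cd_vertices g n zero_divisor_indices"
proof
  show "adj u v \<Longrightarrow> u \<in> zero_divisor_indices" for u v by (rule adj_zero_divisor_indices)
  show "zero_divisor_indices \<subseteq> {..<2 ^ n} \<times> ({..<2 ^ n} - {0}) \<times> {1, -1}"
    by (auto simp: zero_divisor_indices_def index_range_def)
  show "(top, top, s) \<notin> zero_divisor_indices" if n: "n \<ge> 3" "g (n - 1) = g n" for s
  proof
    assume z: "(top, top, s) \<in> zero_divisor_indices"
    obtain m where m: "n = Suc m" using n by (cases n) auto
    have "s = 1 \<or> s = -1" using z by (auto simp: zero_divisor_indices_def index_range_def)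
    moreover have "g m \<noteq> 0" using g_sign[of m] m by auto
    moreover have "cd_zero_divisor g (Suc n) (Pr (cd_basis n top) (cd_scale s (cd_basis n 0)))"
      using z by (simp add: zero_divisor_indices_def cd_element_def)
    then have "cd_zero_divisor g (Suc (Suc m)) (Pr (cd_basis (Suc m) (2 ^ m)) (cd_scale s (cd_basis (Suc m) 0)))"
      using m by (simp del: cd_basis.simps)
    ultimately show False using not_zero_divisor_top[of g m s] n m by simp
  qed
qed

lemma gamma_e_generators_eq: "gamma_e_generators g n = element_parts n ` zero_divisor_indices"
proof (intro equalityI subsetI)
  fix ab assume "ab \<in> gamma_e_generators g n"
  then obtain a b where ab: "ab = (a, b)" "a \<in> cd_basis_set n - {cd_basis n 0}"
      "b \<in> cd_basis_set n \<union> cd_neg ` cd_basis_set n" "cd_zero_divisor g (Suc n) (Pr a b)"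
    by (auto simp: gamma_e_generators_def)
  obtain i where i: "i < 2 ^ n" "i \<noteq> 0" "a = cd_basis n i"
    using ab(2) by (auto simp: cd_basis_set_def)
  have "\<exists>s j. (s = 1 \<or> s = -1) \<and> j < 2 ^ n \<and> b = cd_scale s (cd_basis n j)"
  proof -
    consider j where "j < 2 ^ n" "b = cd_scale 1 (cd_basis n j)"
      | j where "j < 2 ^ n" "b = cd_scale (-1) (cd_basis n j)"
      using ab(3) by (auto simp: cd_basis_set_def)
    then show ?thesis by cases blast+
  qed
  then obtain s j where j: "s = 1 \<or> s = -1" "j < 2 ^ n" "b = cd_scale s (cd_basis n j)" by blast
  have "element_parts n (i XOR j, i, s) = ab"
    using ab i j by (simp add: element_parts_def)
  moreover from this have "(i XOR j, i, s) \<in> zero_divisor_indices"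
    using ab i j cd_element_parts[of n "(i XOR j, i, s)"]
    by (simp add: zero_divisor_indices_def index_range_def xor_less_two_power)
  ultimately show "ab \<in> element_parts n ` zero_divisor_indices" by (metis imageI)
next
  fix ab assume "ab \<in> element_parts n ` zero_divisor_indices"
  then obtain y i s where z: "(y, i, s) \<in> zero_divisor_indices" and ab: "ab = element_parts n (y, i, s)"
    by auto
  have r: "y < 2 ^ n" "i < 2 ^ n" "i \<noteq> 0" "s = 1 \<or> s = -1"
    and d: "cd_zero_divisor g (Suc n) (cd_element n (y, i, s))"
    using z by (auto simp: zero_divisor_indices_def index_range_def)
  have "cd_basis n i \<noteq> cd_basis n 0"
    using cd_scale_basis_eq_iff[of i n 0 1 1] r by simp
  then show "ab \<in> gamma_e_generators g n"
    using r d xor_less_two_power[of i n y]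
    by (auto simp: gamma_e_generators_def ab element_parts_def cd_element_def cd_basis_set_def)
qed

lemma verts_gamma_e: "verts (gamma_e g n) = element_line n ` zero_divisor_indices"
proof -
  have "verts (gamma_e g n) = (\<lambda>(a, b). cd_line (Pr a b)) ` gamma_e_generators g n"
    by (auto simp: gamma_e_def)
  then show ?thesis
    by (simp add: gamma_e_generators_eq image_image cd_element_parts case_prod_beta)
qed

lemma element_line_eq_iff:
  assumes "u \<in> index_range n" "v \<in> index_range n"
  shows "element_line n u = element_line n v \<longleftrightarrow> u = v"
  using cd_line_element_inj assms by (auto dest: inj_onD)

text \<open>Adjacency already implies that the two triples are distinct indices of zero divisors, so
  all side conditions on arcs are absorbed.\<close>

lemma arcs_gamma_e: "arcs (gamma_e g n) = {(element_line n u, element_line n v) |u v. adj u v}"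
proof -
  have "arcs (gamma_e g n) = {(element_line n u, element_line n v) |u v.
      u \<in> zero_divisor_indices \<and> v \<in> zero_divisor_indices \<and>
      element_line n u \<noteq> element_line n v \<and> cd_orthogonal g (Suc n) (cd_element n u) (cd_element n v)}"
    (is "_ = ?S")
  proof (intro equalityI subsetI)
    fix e assume "e \<in> arcs (gamma_e g n)"
    then obtain a b c d where e: "e = (cd_line (Pr a b), cd_line (Pr c d))"
        "(a, b) \<in> gamma_e_generators g n" "(c, d) \<in> gamma_e_generators g n"
        "cd_line (Pr a b) \<noteq> cd_line (Pr c d)" "cd_orthogonal g (Suc n) (Pr a b) (Pr c d)"
      unfolding gamma_e_def pre_digraph.select_convs by blast
    then obtain u v where uv: "u \<in> zero_divisor_indices" "v \<in> zero_divisor_indices"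
        "element_parts n u = (a, b)" "element_parts n v = (c, d)"
      unfolding gamma_e_generators_eq by (metis imageE)
    then have el: "Pr a b = cd_element n u" "Pr c d = cd_element n v" by (simp_all add: cd_element_parts)
    show "e \<in> ?S" using e(1,4,5) uv(1,2) unfolding el by blast
  next
    fix e assume "e \<in> ?S"
    then obtain u v where uv: "u \<in> zero_divisor_indices" "v \<in> zero_divisor_indices"
        "element_line n u \<noteq> element_line n v" "cd_orthogonal g (Suc n) (cd_element n u) (cd_element n v)"
        "e = (element_line n u, element_line n v)"
      by blast
    obtain a b c d where abcd: "element_parts n u = (a, b)" "element_parts n v = (c, d)"
      by (cases "element_parts n u"; cases "element_parts n v")
    then have "(a, b) \<in> gamma_e_generators g n" "(c, d) \<in> gamma_e_generators g n"
      unfolding gamma_e_generators_eq using uv by (metis imageI)+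
    moreover have el: "cd_element n u = Pr a b" "cd_element n v = Pr c d"
      using abcd by (simp_all add: cd_element_parts)
    ultimately show "e \<in> arcs (gamma_e g n)"
      using uv(3-5) unfolding el gamma_e_def pre_digraph.select_convs by blast
  qed
  also have "\<dots> = {(element_line n u, element_line n v) |u v. adj u v}"
  proof -
    have "u \<in> zero_divisor_indices \<and> v \<in> zero_divisor_indices \<and> element_line n u \<noteq> element_line n v \<and>
        cd_orthogonal g (Suc n) (cd_element n u) (cd_element n v) \<longleftrightarrow> adj u v" for u v
      using adj_index_range[of u v] adj_zero_divisor_indices[of u v] adj_zero_divisor_indices[of v u]
        adj_sym[of u v] cd_orthogonal_element_iff[of u v] element_line_eq_iff[of u v]
      unfolding zero_divisor_indices_def by blast
    then show ?thesis by simp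
  qed
  finally show ?thesis .
qed

lemma adj_iff_arc:
  assumes "u \<in> zero_divisor_indices" "v \<in> zero_divisor_indices"
  shows "adj u v \<longleftrightarrow> (element_line n u, element_line n v) \<in> arcs (gamma_e g n)"
proof
  assume "adj u v"
  then show "(element_line n u, element_line n v) \<in> arcs (gamma_e g n)"
    unfolding arcs_gamma_e by blast
next
  assume "(element_line n u, element_line n v) \<in> arcs (gamma_e g n)"
  then obtain u' v' where *: "adj u' v'" "element_line n u = element_line n u'" "element_line n v = element_line n v'"
    unfolding arcs_gamma_e by blast
  moreover have "u \<in> index_range n" "v \<in> index_range n" "u' \<in> index_range n" "v' \<in> index_range n"
    using assms adj_index_range[OF *(1)] by (simp_all add: zero_divisor_indices_def)
  ultimately show "adj u v" using element_line_eq_iff by simp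
qed

lemma inj_on_element_line: "inj_on (element_line n) zero_divisor_indices"
  by (rule inj_on_subset[OF cd_line_element_inj]) (simp add: zero_divisor_indices_def)

lemma wf_digraph_gamma_e: "wf_digraph (gamma_e g n)"
proof
  fix e assume "e \<in> arcs (gamma_e g n)"
  then obtain u v where "e = (element_line n u, element_line n v)" "adj u v"
    unfolding arcs_gamma_e by blast
  moreover from this have "u \<in> zero_divisor_indices" "v \<in> zero_divisor_indices"
    using adj_zero_divisor_indices adj_sym by blast+
  moreover have "tail (gamma_e g n) = fst" "head (gamma_e g n) = snd" by (simp_all add: gamma_e_def)
  ultimately show "tail (gamma_e g n) e \<in> verts (gamma_e g n)" "head (gamma_e g n) e \<in> verts (gamma_e g n)"
    by (auto simp: verts_gamma_e)
qed

text \<open>The product of \<open>e_i\<close> and \<open>s e_(i XOR z)\<close> is \<open>e_z\<close>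
  up to sign, so the condition on the product reads off the first coordinate of the triple.\<close>

lemma gamma_e_C_eq:
  assumes "y < 2 ^ n"
  shows "gamma_e_C g n (cd_basis n y) =
    gamma_e g n \<restriction> element_line n ` cd_vertices.block zero_divisor_indices y"
proof -
  interpret cd_vertices g n zero_divisor_indices by (rule cd_vertices_zero_divisor_indices)
  have mult: "cd_mult g n (fst (element_parts n u)) (snd (element_parts n u)) = cd_basis n y \<or>
      cd_mult g n (fst (element_parts n u)) (snd (element_parts n u)) = cd_neg (cd_basis n y) \<longleftrightarrow>
      fst u = y" if u: "u \<in> zero_divisor_indices" for u
  proof -
    obtain z i s where [simp]: "u = (z, i, s)" by (cases u)
    have r: "z < 2 ^ n" "i < 2 ^ n" "s = 1 \<or> s = -1" "i XOR z < 2 ^ n"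
      using u by (auto simp: zero_divisor_indices_def index_range_def xor_less_two_power)
    have "s * sg n i (i XOR z) = 1 \<or> s * sg n i (i XOR z) = -1"
      using r by (intro sign_mult sg_sign) auto
    then show ?thesis
      using r assms cd_scale_basis_eq_iff[of z n y _ 1] cd_scale_basis_eq_iff[of z n y _ "-1"]
      by (auto simp: element_parts_def cd_mult_basis)
  qed
  have "{cd_line (Pr a b) |a b. (a, b) \<in> gamma_e_generators g n \<and>
      (cd_mult g n a b = cd_basis n y \<or> cd_mult g n a b = cd_neg (cd_basis n y))} =
      element_line n ` {u \<in> zero_divisor_indices.
        cd_mult g n (fst (element_parts n u)) (snd (element_parts n u)) = cd_basis n y \<or>
        cd_mult g n (fst (element_parts n u)) (snd (element_parts n u)) = cd_neg (cd_basis n y)}"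
    (is "?L = ?R")
  proof (intro equalityI subsetI)
    fix x assume "x \<in> ?L"
    then obtain a b where ab: "x = cd_line (Pr a b)" "(a, b) \<in> gamma_e_generators g n"
        "cd_mult g n a b = cd_basis n y \<or> cd_mult g n a b = cd_neg (cd_basis n y)"
      by blast
    then obtain u where "u \<in> zero_divisor_indices" "element_parts n u = (a, b)"
      unfolding gamma_e_generators_eq by (metis imageE)
    then show "x \<in> ?R" using ab by (intro image_eqI[of _ _ u]) (simp_all add: cd_element_parts)
  next
    fix x assume "x \<in> ?R"
    then obtain u where u: "x = element_line n u" "u \<in> zero_divisor_indices"
        "cd_mult g n (fst (element_parts n u)) (snd (element_parts n u)) = cd_basis n y \<or>
         cd_mult g n (fst (element_parts n u)) (snd (element_parts n u)) = cd_neg (cd_basis n y)"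
      by blast
    moreover have "(fst (element_parts n u), snd (element_parts n u)) \<in> gamma_e_generators g n"
      unfolding gamma_e_generators_eq using u(2) by simp
    ultimately show "x \<in> ?L" unfolding cd_element_parts by blast
  qed
  also have "\<dots> = element_line n ` block y"
    unfolding block_def using mult by (intro arg_cong[of _ _ "image _"]) blast
  finally show ?thesis by (simp add: gamma_e_C_def)
qed

end

section \<open>Passage between digraph isomorphisms and bijections of indices\<close>

lemma digraph_iso_imp_graph_bijection:
  assumes "cd_signs g n" "cd_signs h n" "digraph_iso (gamma_e g n) (gamma_e h n)"
  obtains f where "graph_bijection f (cd_signs.zero_divisor_indices g n) (cd_signs.adj g n)
    (cd_signs.zero_divisor_indices h n) (cd_signs.adj h n)"
proof -
  interpret G: cd_signs g n by fact
  interpret H: cd_signs h n by fact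
  let ?V = "G.zero_divisor_indices" and ?W = "H.zero_divisor_indices" and ?l = "element_line n"
  obtain p where p: "pre_digraph.digraph_isomorphism (gamma_e g n) p" "gamma_e h n = app_iso p (gamma_e g n)"
    using assms(3) by (auto simp: digraph_iso_def)
  have lV: "bij_betw ?l ?V (verts (gamma_e g n))" and lW: "bij_betw ?l ?W (verts (gamma_e h n))"
    unfolding G.verts_gamma_e H.verts_gamma_e bij_betw_def
    using G.inj_on_element_line H.inj_on_element_line by simp_all
  have pV: "bij_betw (iso_verts p) (verts (gamma_e g n)) (verts (gamma_e h n))"
    unfolding p(2) bij_betw_def verts_app_iso
    using pre_digraph.digraph_isomorphism_inj_on_verts[OF p(1)] by simp
  define f where "f = inv_into ?W ?l \<circ> (iso_verts p \<circ> ?l)"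
  have bij: "bij_betw f ?V ?W"
    unfolding f_def using lV pV bij_betw_inv_into[OF lW] by (intro bij_betw_trans)
  have lf: "?l (f u) = iso_verts p (?l u)" if "u \<in> ?V" for u
  proof -
    have "iso_verts p (?l u) \<in> verts (gamma_e h n)"
      using that lV pV unfolding bij_betw_def by blast
    then show ?thesis unfolding f_def o_def by (rule bij_betw_inv_into_right[OF lW])
  qed
  \<comment> \<open>In both graphs an arc is the pair of its ends, so the map on vertices determines
    the map on arcs.\<close>
  have arc: "iso_arcs p (a, b) = (iso_verts p a, iso_verts p b)" if "(a, b) \<in> arcs (gamma_e g n)" for a b
  proof -
    have "iso_tail p = tail (gamma_e h n)" "iso_head p = head (gamma_e h n)" unfolding p(2) by simp_all
    then have "iso_tail p = fst" "iso_head p = snd" by (simp_all add: gamma_e_def)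
    moreover have "tail (gamma_e g n) (a, b) = a" "head (gamma_e g n) (a, b) = b" by (simp_all add: gamma_e_def)
    ultimately show ?thesis
      using pre_digraph.iso_verts_tail[OF p(1) that] pre_digraph.iso_verts_head[OF p(1) that]
      by (simp add: prod_eq_iff)
  qed
  have adjG: "G.adj u v \<longleftrightarrow> (?l u, ?l v) \<in> arcs (gamma_e g n)" if "u \<in> ?V" "v \<in> ?V" for u v
    using that by (rule G.adj_iff_arc)
  have adjH: "H.adj u v \<longleftrightarrow> (?l u, ?l v) \<in> arcs (gamma_e h n)" if "u \<in> ?W" "v \<in> ?W" for u v
    using that by (rule H.adj_iff_arc)
  have injv: "iso_verts p a = iso_verts p b \<longleftrightarrow> a = b"
    if "a \<in> verts (gamma_e g n)" "b \<in> verts (gamma_e g n)" for a b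
    using that pV by (auto simp: bij_betw_def inj_on_def)
  have edge: "G.adj u v \<longleftrightarrow> H.adj (f u) (f v)" if uv: "u \<in> ?V" "v \<in> ?V" for u v
  proof -
    have fuv: "f u \<in> ?W" "f v \<in> ?W" using uv bij by (auto simp: bij_betw_def)
    have luv: "?l u \<in> verts (gamma_e g n)" "?l v \<in> verts (gamma_e g n)"
      using uv by (auto simp: G.verts_gamma_e)
    have "(iso_verts p (?l u), iso_verts p (?l v)) \<in> iso_arcs p ` arcs (gamma_e g n) \<longleftrightarrow>
        (?l u, ?l v) \<in> arcs (gamma_e g n)"
    proof
      assume "(iso_verts p (?l u), iso_verts p (?l v)) \<in> iso_arcs p ` arcs (gamma_e g n)"
      then obtain a b where ab: "(a, b) \<in> arcs (gamma_e g n)"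
          "(iso_verts p (?l u), iso_verts p (?l v)) = (iso_verts p a, iso_verts p b)"
        using arc by force
      moreover have "a \<in> verts (gamma_e g n)" "b \<in> verts (gamma_e g n)"
        using ab wf_digraph.head_in_verts[OF G.wf_digraph_gamma_e, of "(a, b)"]
          wf_digraph.tail_in_verts[OF G.wf_digraph_gamma_e, of "(a, b)"] by (auto simp: gamma_e_def)
      ultimately show "(?l u, ?l v) \<in> arcs (gamma_e g n)" using injv luv by auto
    next
      assume "(?l u, ?l v) \<in> arcs (gamma_e g n)"
      then show "(iso_verts p (?l u), iso_verts p (?l v)) \<in> iso_arcs p ` arcs (gamma_e g n)"
        using arc by (metis imageI)
    qed
    then show ?thesis
      unfolding adjG[OF uv] adjH[OF fuv] lf[OF uv(1)] lf[OF uv(2)] p(2) arcs_app_iso by simp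
  qed
  have "graph_bijection f ?V G.adj ?W H.adj"
    using bij edge G.adj_zero_divisor_indices H.adj_zero_divisor_indices G.adj_sym H.adj_sym
    by unfold_locales blast+
  then show thesis by (rule that)
qed

text \<open>The bijection is carried over to lines and acts on arcs componentwise; the assumption on
  blocks transfers the induced subgraph.\<close>

lemma graph_bijection_imp_graph_iso:
  assumes "cd_signs g n" "cd_signs h n" "y < 2 ^ n"
    and "graph_bijection f (cd_signs.zero_divisor_indices g n) (cd_signs.adj g n)
      (cd_signs.zero_divisor_indices h n) (cd_signs.adj h n)"
    and "f ` cd_vertices.block (cd_signs.zero_divisor_indices g n) y =
      cd_vertices.block (cd_signs.zero_divisor_indices h n) y"
  obtains p where "is_graph_iso p (gamma_e g n) (gamma_e h n)"
    "app_iso p (gamma_e_C g n (cd_basis n y)) = gamma_e_C h n (cd_basis n y)"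
proof -
  interpret G: cd_signs g n by fact
  interpret H: cd_signs h n by fact
  let ?V = "G.zero_divisor_indices" and ?W = "H.zero_divisor_indices" and ?l = "element_line n"
  interpret f: graph_bijection f ?V G.adj ?W H.adj by fact
  interpret VG: cd_vertices g n ?V by (rule G.cd_vertices_zero_divisor_indices)
  interpret VH: cd_vertices h n ?W by (rule H.cd_vertices_zero_divisor_indices)
  note injV = G.inj_on_element_line and injW = H.inj_on_element_line
  define q where "q = ?l \<circ> f \<circ> inv_into ?V ?l"
  have q: "q (?l u) = ?l (f u)" if "u \<in> ?V" for u
    using that by (simp add: q_def inv_into_f_f[OF injV])
  have fV: "f ` ?V = ?W" "inj_on f ?V" using f.bij by (auto simp: bij_betw_def)
  have q_verts: "q ` verts (gamma_e g n) = verts (gamma_e h n)"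
    unfolding G.verts_gamma_e H.verts_gamma_e fV(1)[symmetric] image_image using q by simp
  have inj_q: "inj_on q (verts (gamma_e g n))"
    unfolding G.verts_gamma_e
  proof (rule inj_onI)
    fix a b assume "a \<in> ?l ` ?V" "b \<in> ?l ` ?V" and eq: "q a = q b"
    then obtain u v where uv: "u \<in> ?V" "v \<in> ?V" "a = ?l u" "b = ?l v" by blast
    then have "?l (f u) = ?l (f v)" using eq q by simp
    then have "f u = f v" using uv fV injW by (metis imageI inj_onD)
    then show "a = b" using uv fV by (metis inj_onD)
  qed
  define r where "r = (\<lambda>(a, b). (q a, q b))"
  have r_arcs: "r ` arcs (gamma_e g n) = arcs (gamma_e h n)"
  proof (intro equalityI subsetI)
    fix e assume "e \<in> r ` arcs (gamma_e g n)"
    then obtain e' where "e' \<in> arcs (gamma_e g n)" "e = r e'" by blast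
    then obtain u v where uv: "G.adj u v" "e = r (?l u, ?l v)"
      unfolding G.arcs_gamma_e by blast
    then have "u \<in> ?V" "v \<in> ?V" using f.E_V by blast+
    then have "H.adj (f u) (f v)" "e = (?l (f u), ?l (f v))"
      using uv f.edge q by (simp_all add: r_def del: H.adj.simps G.adj.simps)
    then show "e \<in> arcs (gamma_e h n)" unfolding H.arcs_gamma_e by blast
  next
    fix e assume "e \<in> arcs (gamma_e h n)"
    then obtain w x where wx: "H.adj w x" "e = (?l w, ?l x)" unfolding H.arcs_gamma_e by blast
    then obtain u v where uv: "u \<in> ?V" "v \<in> ?V" "w = f u" "x = f v" using f.F_W fV(1) by blast
    then have "G.adj u v" "e = r (?l u, ?l v)"
      using wx f.edge q by (simp_all add: r_def del: H.adj.simps G.adj.simps)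
    then show "e \<in> r ` arcs (gamma_e g n)" unfolding G.arcs_gamma_e by blast
  qed
  have arcs_verts: "fst e \<in> verts (gamma_e g n) \<and> snd e \<in> verts (gamma_e g n)"
    if "e \<in> arcs (gamma_e g n)" for e
    using that wf_digraph.head_in_verts[OF G.wf_digraph_gamma_e, of e]
      wf_digraph.tail_in_verts[OF G.wf_digraph_gamma_e, of e] by (auto simp: gamma_e_def)
  have inj_r: "inj_on r (arcs (gamma_e g n))"
  proof (rule inj_onI)
    fix e e' assume "e \<in> arcs (gamma_e g n)" "e' \<in> arcs (gamma_e g n)" "r e = r e'"
    then show "e = e'"
      using arcs_verts[of e] arcs_verts[of e'] inj_q by (auto simp: r_def dest: inj_onD split: prod.splits)
  qed
  define p where "p = \<lparr>iso_verts = q, iso_arcs = r, iso_head = snd, iso_tail = fst\<rparr>"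
  have th: "tail (gamma_e k m) = fst" "head (gamma_e k m) = snd" for k m by (simp_all add: gamma_e_def)
  have "pre_digraph.digraph_isomorphism (gamma_e g n) p"
    unfolding pre_digraph.digraph_isomorphism_def
    using G.wf_digraph_gamma_e inj_q inj_r by (auto simp: p_def r_def th)
  moreover have "gamma_e h n = app_iso p (gamma_e g n)"
    unfolding app_iso_def p_def by (rule pre_digraph.equality) (simp_all add: q_verts r_arcs th)
  ultimately have iso: "is_graph_iso p (gamma_e g n) (gamma_e h n)" by (simp add: is_graph_iso_def)
  let ?A = "?l ` VG.block y" and ?B = "?l ` VH.block y"
  have AV: "?A \<subseteq> verts (gamma_e g n)" by (auto simp: G.verts_gamma_e VG.block_def)
  have qA: "q ` ?A = ?B"
    using q unfolding assms(5)[symmetric] image_image by (intro image_cong) (auto simp: VG.block_def)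
  \<comment> \<open>By injectivity only vertices of the original block are mapped into the image
    block, so the arcs of the two induced subgraphs correspond.\<close>
  have qmem: "q a \<in> ?B \<longleftrightarrow> a \<in> ?A" if "a \<in> verts (gamma_e g n)" for a
    using inj_on_image_mem_iff[OF inj_q that AV] unfolding qA .
  have "r ` {e \<in> arcs (gamma_e g n). fst e \<in> ?A \<and> snd e \<in> ?A} =
      {e \<in> arcs (gamma_e h n). fst e \<in> ?B \<and> snd e \<in> ?B}"
  proof -
    have "fst (r e) \<in> ?B \<and> snd (r e) \<in> ?B \<longleftrightarrow> fst e \<in> ?A \<and> snd e \<in> ?A"
      if "e \<in> arcs (gamma_e g n)" for e
      using qmem arcs_verts[OF that] by (cases e) (simp add: r_def)
    then show ?thesis unfolding r_arcs[symmetric] by blast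
  qed
  then have "app_iso p (gamma_e_C g n (cd_basis n y)) = gamma_e_C h n (cd_basis n y)"
    unfolding G.gamma_e_C_eq[OF assms(3)] H.gamma_e_C_eq[OF assms(3)]
    unfolding app_iso_def p_def
    by (intro pre_digraph.equality) (simp_all add: qA th)
  then show thesis using iso that by blast
qed

theorem lemma5p2:
  fixes n :: nat and \<gamma> \<delta> :: "nat \<Rightarrow> real"
  assumes "\<forall>i\<le>n. \<gamma> i \<in> {1, -1}" and "\<forall>i\<le>n. \<delta> i \<in> {1, -1}"
    and "digraph_iso (gamma_e \<gamma> n) (gamma_e \<delta> n)"
  shows "(n \<ge> 3 \<longrightarrow>
            \<gamma> n = \<delta> n \<and>
            (\<gamma> n = 1 \<longrightarrow>
               (\<exists>f. is_graph_iso f (gamma_e \<gamma> n) (gamma_e \<delta> n) \<and>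
                    app_iso f (gamma_e_C \<gamma> n (cd_basis n 0)) = gamma_e_C \<delta> n (cd_basis n 0)))) \<and>
         (n \<ge> 4 \<longrightarrow>
            \<gamma> (n - 1) = \<delta> (n - 1) \<and>
            (\<exists>f. is_graph_iso f (gamma_e \<gamma> n) (gamma_e \<delta> n) \<and>
                 app_iso f (gamma_e_C \<gamma> n (cd_basis n (2 ^ (n - 1)))) =
                   gamma_e_C \<delta> n (cd_basis n (2 ^ (n - 1)))))"
proof -
  have G: "cd_signs \<gamma> n" and H: "cd_signs \<delta> n" using assms by (auto simp: cd_signs_def)
  note VG = cd_signs.cd_vertices_zero_divisor_indices[OF G]
    and VH = cd_signs.cd_vertices_zero_divisor_indices[OF H]
  obtain f where f: "graph_bijection f (cd_signs.zero_divisor_indices \<gamma> n) (cd_signs.adj \<gamma> n)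
      (cd_signs.zero_divisor_indices \<delta> n) (cd_signs.adj \<delta> n)"
    using digraph_iso_imp_graph_bijection[OF G H assms(3)] .
  have "\<exists>f. is_graph_iso f (gamma_e \<gamma> n) (gamma_e \<delta> n) \<and>
      app_iso f (gamma_e_C \<gamma> n (cd_basis n 0)) = gamma_e_C \<delta> n (cd_basis n 0)" if "n \<ge> 3" "\<gamma> n = 1"
    using graph_bijection_imp_graph_iso[OF G H _ f, of 0] last_sign_determined(2)[OF VG VH _ f] that
    by (metis zero_less_power zero_less_numeral)
  moreover have "\<exists>f. is_graph_iso f (gamma_e \<gamma> n) (gamma_e \<delta> n) \<and>
      app_iso f (gamma_e_C \<gamma> n (cd_basis n (2 ^ (n - 1)))) = gamma_e_C \<delta> n (cd_basis n (2 ^ (n - 1)))"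
    if n: "n \<ge> 4"
  proof -
    obtain f' where f': "graph_bijection f' (cd_signs.zero_divisor_indices \<gamma> n) (cd_signs.adj \<gamma> n)
        (cd_signs.zero_divisor_indices \<delta> n) (cd_signs.adj \<delta> n)"
      "f' ` cd_vertices.block (cd_signs.zero_divisor_indices \<gamma> n) (2 ^ (n - 1)) =
        cd_vertices.block (cd_signs.zero_divisor_indices \<delta> n) (2 ^ (n - 1))"
      using top_sign_determined(2)[OF VG VH n f] by blast
    have "(2::nat) ^ (n - 1) < 2 ^ n" using n by simp
    then show ?thesis using graph_bijection_imp_graph_iso[OF G H _ f'] by metis
  qed
  ultimately show ?thesis
    using last_sign_determined(1)[OF VG VH _ f] top_sign_determined(1)[OF VG VH _ f] by blast
qed

end
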